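(* Let $n\ge2$, $1\le m<n$, let $(\Sigma_t)_{t\in[0,1]}$ be a continuously differentiable curve in $\mathrm{Sym}^+(n)$, and let $Y_0,Y_1\in\mathbb{R}^{n\times m}$. If there exists at least one admissible pair for Problem 1, then Problem 1 has an absolute (global) minimizer $(K^\star_t,\Phi^\star_t)_{t\in[0,1]}$ among all admissible pairs.
   Context: $\mathrm{Sym}^+(n)$ denotes the set of real symmetric positive-definite $n\times n$ matrices and $\mathrm{GL}(n)$ the group of real invertible $n\times n$ matrices. Given $\Sigma_0\in\mathrm{Sym}^+(n)$, for a pair of curves $(K_t,\Phi_t)_{t\in[0,1]}$ the kinetic energy cost is $J_{\rm KE}=\frac12\int_0^1\mathrm{tr}(K_t\Phi_t\Sigma_0\Phi_t^\top K_t^\top)\,dt$. Problem 1: given a continuously differentiable curve $(\Sigma_t)_{t\in[0,1]}$ in $\mathrm{Sym}^+(n)$ and $Y_0,Y_1\in\mathbb{R}^{n\times m}$ ($m<n$), minimize $J_{\rm KE}$ over pairs $(K_t,\Phi_t)_{t\in[0,1]}$ subject to: $\dot\Phi_t=K_t\Phi_t$, $\Phi_0=I$; $\Sigma_t=\Phi_t\Sigma_0\Phi_t^\top$ for all $t\in[0,1]$; and $Y_1=\Phi_1Y_0$. A pair $(K_t,\Phi_t)_{t\in[0,1]}$ is admissible for Problem 1 if $(K_t)$ is square integrable, $(\Phi_t)$ is absolutely continuous with values in $\mathrm{GL}(n)$, $\Phi_0=I$ and $\dot\Phi_t=K_t\Phi_t$ wherever $\dot\Phi_t$ exists, $\Sigma_t=\Phi_t\Sigma_0\Phi_t^\top$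 for all $t\in[0,1]$, $Y_1=\Phi_1Y_0$, and $J_{\rm KE}<\infty$. *)

theory Defs
  imports "HOL-Analysis.Analysis"
begin

definition SymPos :: "(real^'n^'n) set" where
  "SymPos = {A. transpose A = A \<and> (\<forall>x. x \<noteq> 0 \<longrightarrow> x \<bullet> (A *v x) > 0)}"

definition C1_curve :: "(real \<Rightarrow> 'a::real_normed_vector) \<Rightarrow> bool" where
  "C1_curve S \<longleftrightarrow> (\<exists>S'. (\<forall>t\<in>{0..1}. (S has_vector_derivative S' t) (at t within {0..1}))
                        \<and> continuous_on {0..1} S')"

definition abs_cont_on :: "real \<Rightarrow> real \<Rightarrow> (real \<Rightarrow> 'a::real_normed_vector) \<Rightarrow> bool" where
  "abs_cont_on a b f \<longleftrightarrow>
     (\<forall>e>0. \<exists>d>0. \<forall>(N::nat) (u::nat \<Rightarrow> real) v.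
        (\<forall>i<N. a \<le> u i \<and> u i \<le> v i \<and> v i \<le> b) \<and>
        (\<forall>i<N. \<forall>j<N. i \<noteq> j \<longrightarrow> v i \<le> u j \<or> v j \<le> u i) \<and>
        (\<Sum>i<N. v i - u i) < d
        \<longrightarrow> (\<Sum>i<N. norm (f (v i) - f (u i))) < e)"

definition KE_integrand ::
  "real^'n^'n \<Rightarrow> (real \<Rightarrow> real^'n^'n) \<Rightarrow> (real \<Rightarrow> real^'n^'n) \<Rightarrow> real \<Rightarrow> real" where
  "KE_integrand S0 K Phi t =
     trace (K t ** Phi t ** S0 ** transpose (Phi t) ** transpose (K t))"

definition J_KE ::
  "real^'n^'n \<Rightarrow> (real \<Rightarrow> real^'n^'n) \<Rightarrow> (real \<Rightarrow> real^'n^'n) \<Rightarrow> real" where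
  "J_KE S0 K Phi = (1/2) * integral\<^sup>L (lebesgue_on {0..1}) (KE_integrand S0 K Phi)"

definition admissible ::
  "(real \<Rightarrow> real^'n^'n) \<Rightarrow> real^'m^'n \<Rightarrow> real^'m^'n \<Rightarrow>
   (real \<Rightarrow> real^'n^'n) \<Rightarrow> (real \<Rightarrow> real^'n^'n) \<Rightarrow> bool" where
  "admissible Sig Y0 Y1 K Phi \<longleftrightarrow>
     K \<in> borel_measurable (lebesgue_on {0..1}) \<and>
     integrable (lebesgue_on {0..1}) (\<lambda>t. (norm (K t))\<^sup>2) \<and>
     abs_cont_on 0 1 Phi \<and>
     (\<forall>t\<in>{0..1}. invertible (Phi t)) \<and>
     Phi 0 = mat 1 \<and>
     (\<forall>t\<in>{0<..<1}. \<forall>D. (Phi has_vector_derivative D) (at t) \<longrightarrow> D = K t ** Phi t) \<and>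
     (\<forall>t\<in>{0..1}. Sig t = Phi t ** Sig 0 ** transpose (Phi t)) \<and>
     Y1 = Phi 1 ** Y0 \<and>
     integrable (lebesgue_on {0..1}) (KE_integrand (Sig 0) K Phi)"

end

theory Submission
  imports Defs "HOL-Complex_Analysis.Great_Picard"
begin

text \<open>
  Since \<open>K \<Phi> = \<Phi>'\<close>, the cost is half the integral of \<open>tr (\<Phi>' \<Sigma>\<^sub>0 \<Phi>'\<^sup>T)\<close>, a coercive quadratic form of
  the velocity of \<open>\<Phi>\<close> alone, so the direct method applies. By Jensen's inequality the integral dominates the
  discrete energies \<open>\<Sum> Q (\<Phi> v - \<Phi> u) / (v - u)\<close> over nonoverlapping intervals, where \<open>Q\<close> is the quadratic
  form. These are continuous under pointwise convergence and give a uniform Hoelder bound, so a minimizing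
  sequence subconverges uniformly (Arzela-Ascoli) to a curve whose discrete energies are bounded by twice the
  infimum; the remaining constraints are pointwise and closed. Such a curve is absolutely continuous, and its
  velocity satisfies the same energy bound.

  Both directions rest on Lebesgue's theorem that an absolutely continuous curve is differentiable almost
  everywhere and is the integral of its derivative; it is obtained from the Vitali covering theorem and a
  gauge argument.
\<close>

(* Polynomial.content would otherwise shadow the content of an interval. *)
hide_const (open) Polynomial.content

text \<open>The clause \<open>D = K t ** Phi t\<close> in \<open>admissible\<close> is silent where
  \<open>Phi\<close> has no derivative, so without almost everywhere differentiability the cost
  would be unrelated to the motion of \<open>Phi\<close>; this is why Lebesgue's theorem precedes
  the variational argument. Discrete energies replace weak convergence of velocities: only pointwise
  limits of curves occur, and \<open>K\<close> is never followed along the sequence but rebuilt from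
  the limit curve as velocity times inverse. Invertibility is not a closed condition; it survives
  because the limit still satisfies the constraint on \<open>Sig\<close>, whose determinants are
  nonzero. Velocities are integrated as gauge integrals, since absolute continuity controls exactly
  the part of a Riemann sum that is tagged in the exceptional null set.\<close>

section \<open>Differentiability of absolutely continuous functions\<close>

text \<open>The guard on the empty set makes \<open>incr f\<close> additive on all intervals, including empty intersections.\<close>

definition incr :: "(real \<Rightarrow> 'a::real_normed_vector) \<Rightarrow> real set \<Rightarrow> 'a" where
  "incr f k = (if k = {} then 0 else f (Sup k) - f (Inf k))"

lemma incr_content_0:
  assumes "content {u..v} = 0" shows "incr f {u..v} = 0"
proof (cases "u \<le> v")
  case True
  with assms have "u = v" by (simp add: content_real)
  then show ?thesis by (simp add: incr_def)
qed (simp add: incr_def)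

text \<open>Vanishing on degenerate intervals and additivity under bisection make
  \<open>incr f\<close> operative, and operative functions sum over divisions.\<close>

lemma sum_incr_division:
  assumes "p division_of {a..b}"
  shows "sum (incr f) p = incr f {a..b}"
proof -
  interpret operative_real plus 0 "incr f"
    rewrites "comm_monoid_set.F (+) 0 = sum"
    by standard[1] (auto simp add: sum_def incr_def)
  show ?thesis using division assms by simp
qed

lemma content_eq_incr: "content {u..v} = incr (\<lambda>x. x) {u..v::real}"
  by (simp add: incr_def content_real_if)

text \<open>The traces of the pieces of \<open>q\<close> on \<open>k\<close> form a division of
  \<open>k\<close>, so the increments telescope; empty traces count zero by the guard in
  \<open>incr\<close>.\<close>

lemma incr_Int_division:
  assumes q: "q division_of {a..b}" and k: "k = {u..v}" "k \<subseteq> {a..b}"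
  shows "(\<Sum>l\<in>q. incr f (k \<inter> l)) = incr f k"
proof -
  have fin: "finite q" using q by auto
  let ?q = "{l\<in>q. k \<inter> l \<noteq> {}}"
  have eq: "{cbox u v \<inter> l | l. l \<in> q \<and> cbox u v \<inter> l \<noteq> {}} = (\<lambda>l. k \<inter> l) ` ?q"
    using k by auto
  have div: "(\<lambda>l. k \<inter> l) ` ?q division_of {u..v}"
    using division_inter_1[OF q, of u v] k unfolding eq by simp
  have "incr f k = sum (incr f) ((\<lambda>l. k \<inter> l) ` ?q)"
    using sum_incr_division[OF div, of f, symmetric] unfolding k(1) .
  also have "\<dots> = sum (incr f \<circ> (\<lambda>l. k \<inter> l)) ?q"
  \<comment> \<open>Distinct pieces may leave the same trace on \<open>k\<close>, but only one
    without interior, which has length zero and hence increment zero.\<close>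
  proof (rule sum.reindex_nontrivial)
    show "finite ?q" using fin by auto
    fix x y assume xy: "x \<in> ?q" "y \<in> ?q" "x \<noteq> y" "k \<inter> x = k \<inter> y"
    have "interior (k \<inter> x) \<subseteq> interior x \<inter> interior y"
      using xy(4) by (metis Int_lower2 inf.bounded_iff interior_mono)
    also have "\<dots> = {}" using q xy by auto
    finally have e: "interior (k \<inter> x) = {}" by simp
    obtain c d where x: "x = {c..d}" using q xy by (metis (no_types, lifting) box_real(2) division_ofD(4) mem_Collect_eq)
    have kx: "k \<inter> x = {max u c..min v d}" using x k by auto
    have "content {max u c..min v d} = 0"
      using e unfolding kx by (auto simp: content_real_if min_def max_def split: if_splits)
    then show "incr f (k \<inter> x) = 0" unfolding kx by (rule incr_content_0)
  qed
  also have "\<dots> = (\<Sum>l\<in>q. incr f (k \<inter> l))"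
    by (rule sum.mono_neutral_cong_left) (use fin in \<open>auto simp: incr_def\<close>)
  finally show ?thesis by simp
qed

text \<open>Set counterpart of the indexed interval systems in \<open>abs_cont_on\<close>, matching
  the way divisions and Vitali families deliver their pieces. Point intervals, and even the empty
  set, may be members.\<close>

definition nonoverlapping :: "real \<Rightarrow> real \<Rightarrow> real set set \<Rightarrow> bool" where
  "nonoverlapping a b D \<longleftrightarrow> finite D \<and> (\<forall>k\<in>D. \<exists>u v. k = {u..v} \<and> a \<le> u \<and> v \<le> b) \<and>
     (\<forall>k\<in>D. \<forall>l\<in>D. k \<noteq> l \<longrightarrow> interior k \<inter> interior l = {})"

text \<open>One enumeration has to serve lengths and increments at once, hence the quantifier over
  \<open>h\<close> inside the conclusion; vanishing on degenerate intervals makes up for the members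
  that are dropped.\<close>

lemma nonoverlapping_enumerate:
  assumes D: "nonoverlapping a b D"
  obtains N and u v :: "nat \<Rightarrow> real" where
    "\<forall>i<N. a \<le> u i \<and> u i \<le> v i \<and> v i \<le> b"
    "\<forall>i<N. \<forall>j<N. i \<noteq> j \<longrightarrow> v i \<le> u j \<or> v j \<le> u i"
    "\<forall>h::real set \<Rightarrow> real. (\<forall>u v. content {u..v} = 0 \<longrightarrow> h {u..v} = 0) \<longrightarrow> sum h D = (\<Sum>i<N. h {u i..v i})"
proof -
  have fin: "finite D"
    and ivl: "\<And>k. k \<in> D \<Longrightarrow> \<exists>u v. k = {u..v} \<and> a \<le> u \<and> v \<le> b"
    and disj: "\<And>k l. k \<in> D \<Longrightarrow> l \<in> D \<Longrightarrow> k \<noteq> l \<Longrightarrow> interior k \<inter> interior l = {}"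
    using D unfolding nonoverlapping_def by blast+
  \<comment> \<open>A point interval may lie inside another member although the interiors are
    disjoint; the ordering of endpoints would then fail, so only members of positive length are
    numbered.\<close>
  let ?D = "{k\<in>D. content k \<noteq> 0}"
  have finD: "finite ?D" using fin by auto
  obtain h where h: "bij_betw h {..<card ?D} ?D"
    using ex_bij_betw_nat_finite[OF finD] by (auto simp: atLeast0LessThan)
  let ?N = "card ?D"
  have hin: "h i \<in> D" "content (h i) \<noteq> 0" if "i < ?N" for i
    using bij_betwE[OF h] that by auto
  have hI: "\<exists>u v. h i = {u..v} \<and> a \<le> u \<and> v \<le> b \<and> u < v" if "i < ?N" for i
    using ivl[OF hin(1)[OF that]] hin(2)[OF that] by (auto simp: content_real_if split: if_splits)
  obtain u v where uv: "\<And>i. i < ?N \<Longrightarrow> h i = {u i..v i} \<and> a \<le> u i \<and> v i \<le> b \<and> u i < v i"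
    using hI by metis
  show ?thesis
  proof (rule that)
    show "\<forall>i<?N. a \<le> u i \<and> u i \<le> v i \<and> v i \<le> b" using uv by force
    show "\<forall>i<?N. \<forall>j<?N. i \<noteq> j \<longrightarrow> v i \<le> u j \<or> v j \<le> u i"
    proof (intro allI impI)
      fix i j assume ij: "i < ?N" "j < ?N" "i \<noteq> j"
      then have "h i \<noteq> h j" using h by (auto simp: bij_betw_def inj_on_def)
      then have "interior (h i) \<inter> interior (h j) = {}" using disj hin ij by blast
      then have "{max (u i) (u j)<..<min (v i) (v j)} = {}" using uv ij by auto
      then show "v i \<le> u j \<or> v j \<le> u i"
        using uv[OF ij(1)] uv[OF ij(2)] by (auto simp: min_def max_def split: if_splits)
    qed
  next
    show "\<forall>H::real set \<Rightarrow> real. (\<forall>u v. content {u..v} = 0 \<longrightarrow> H {u..v} = 0) \<longrightarrow> sum H D = (\<Sum>i<?N. H {u i..v i})"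
    proof (intro allI impI)
      fix H :: "real set \<Rightarrow> real" assume H: "\<forall>u v. content {u..v} = 0 \<longrightarrow> H {u..v} = 0"
      have "sum H D = sum H ?D"
      proof (rule sum.mono_neutral_right)
        show "\<forall>k\<in>D - ?D. H k = 0"
        proof
          fix k assume "k \<in> D - ?D"
          then obtain u v where "k = {u..v}" "content k = 0" using ivl by blast
          then show "H k = 0" using H by auto
        qed
      qed (use fin in auto)
      also have "\<dots> = (\<Sum>i<?N. H (h i))" by (rule sum.reindex_bij_betw[OF h, symmetric])
      also have "\<dots> = (\<Sum>i<?N. H {u i..v i})"
        by (rule sum.cong) (use uv in auto)
      finally show "sum H D = (\<Sum>i<?N. H {u i..v i})" .
    qed
  qed
qed

lemma abs_cont_on_division:
  assumes "abs_cont_on a b f" "e > 0"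
  obtains d where "d > 0"
    "\<And>D. nonoverlapping a b D \<Longrightarrow> sum content D < d \<Longrightarrow> (\<Sum>k\<in>D. norm (incr f k)) < e"
proof -
  obtain d where d: "d > 0" and ac: "\<forall>(N::nat) (u::nat \<Rightarrow> real) v.
        (\<forall>i<N. a \<le> u i \<and> u i \<le> v i \<and> v i \<le> b) \<and>
        (\<forall>i<N. \<forall>j<N. i \<noteq> j \<longrightarrow> v i \<le> u j \<or> v j \<le> u i) \<and>
        (\<Sum>i<N. v i - u i) < d
        \<longrightarrow> (\<Sum>i<N. norm (f (v i) - f (u i))) < e"
    using assms(1)[unfolded abs_cont_on_def, rule_format, OF assms(2)] by (elim exE conjE) (rule that)
  show ?thesis
  proof (rule that[OF d])
    fix D assume D: "nonoverlapping a b D" and small: "sum content D < d"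
    obtain N and u v :: "nat \<Rightarrow> real" where
      uv: "\<forall>i<N. a \<le> u i \<and> u i \<le> v i \<and> v i \<le> b"
        "\<forall>i<N. \<forall>j<N. i \<noteq> j \<longrightarrow> v i \<le> u j \<or> v j \<le> u i"
      and enum: "\<forall>h::real set \<Rightarrow> real. (\<forall>u v. content {u..v} = 0 \<longrightarrow> h {u..v} = 0) \<longrightarrow> sum h D = (\<Sum>i<N. h {u i..v i})"
      by (rule nonoverlapping_enumerate[OF D])
    have "sum content D = (\<Sum>i<N. content {u i..v i})" by (rule enum[rule_format])
    also have "\<dots> = (\<Sum>i<N. v i - u i)" by (rule sum.cong) (use uv(1) in auto)
    finally have "(\<Sum>i<N. v i - u i) < d" using small by simp
    then have "(\<Sum>i<N. norm (f (v i) - f (u i))) < e"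
      using ac[rule_format, of N u v] uv by simp
    moreover have "(\<Sum>k\<in>D. norm (incr f k)) = (\<Sum>i<N. norm (incr f {u i..v i}))"
      by (rule enum[rule_format]) (simp add: incr_content_0)
    moreover have "(\<Sum>i<N. norm (incr f {u i..v i})) = (\<Sum>i<N. norm (f (v i) - f (u i)))"
      by (rule sum.cong) (use uv(1) in \<open>auto simp: incr_def\<close>)
    ultimately show "(\<Sum>k\<in>D. norm (incr f k)) < e" by simp
  qed
qed

text \<open>
  Extending \<open>q\<close> to a division of the whole interval, the pieces of \<open>p\<close> outside \<open>q\<close> form a
  nonoverlapping family of total length less than \<open>d\<close>.
\<close>

lemma incr_Int_close:
  fixes f :: "real \<Rightarrow> real"
  assumes ac: "\<And>D. nonoverlapping a b D \<Longrightarrow> sum content D < d \<Longrightarrow> (\<Sum>k\<in>D. norm (incr f k)) < e"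
    and p: "p division_of \<Union>p" "\<Union>p \<subseteq> {a..b}" and q: "q division_of \<Union>q" "\<Union>q \<subseteq> {a..b}"
    and small: "sum content p - (\<Sum>k\<in>p. \<Sum>l\<in>q. content (k \<inter> l)) < d"
  shows "\<bar>sum (incr f) p - (\<Sum>k\<in>p. \<Sum>l\<in>q. incr f (k \<inter> l))\<bar> < e"
proof -
  obtain Q where Q: "q \<subseteq> Q" "Q division_of {a..b}"
    using partial_division_extend_interval[of q a b] q by auto
  have fin: "finite p" "finite Q" "finite q" using p q Q by auto
  have ivp: "\<exists>u v. k = {u..v} \<and> k \<subseteq> {a..b}" if "k \<in> p" for k
    using p that by (metis Union_upper box_real(2) division_ofD(4) subset_trans)
  have ivQ: "\<exists>u v. l = {u..v} \<and> l \<subseteq> {a..b}" if "l \<in> Q" for l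
    using Q that by (metis division_ofD(2) box_real(2) division_ofD(4))
  \<comment> \<open>Stated for general \<open>g\<close>, because it is applied both to
    \<open>f\<close> and to the identity, whose increments are lengths.\<close>
  have split: "sum (incr g) p - (\<Sum>k\<in>p. \<Sum>l\<in>q. incr g (k \<inter> l)) = (\<Sum>(k,l)\<in>p \<times> (Q-q). incr g (k \<inter> l))"
    for g :: "real \<Rightarrow> real"
  proof -
    have "sum (incr g) p = (\<Sum>k\<in>p. \<Sum>l\<in>Q. incr g (k \<inter> l))"
    proof (rule sum.cong[OF refl])
      fix k assume "k \<in> p"
      then obtain u v where "k = {u..v}" "k \<subseteq> {a..b}" using ivp by blast
      then show "incr g k = (\<Sum>l\<in>Q. incr g (k \<inter> l))" using incr_Int_division[OF Q(2)] by metis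
    qed
    also have "\<dots> = (\<Sum>k\<in>p. (\<Sum>l\<in>Q-q. incr g (k \<inter> l)) + (\<Sum>l\<in>q. incr g (k \<inter> l)))"
      using sum.subset_diff[OF Q(1) fin(2)] by (intro sum.cong) auto
    finally show ?thesis
      by (simp add: sum.distrib sum.cartesian_product)
  qed
  have ivpQ: "\<exists>u v. k \<inter> l = {u..v} \<and> (a \<le> b \<longrightarrow> a \<le> u \<and> v \<le> b)" if kl: "k \<in> p" "l \<in> Q" for k l
  proof -
    obtain u v where k: "k = {u..v}" "k \<subseteq> {a..b}" using ivp kl by blast
    obtain u' v' where l: "l = {u'..v'}" "l \<subseteq> {a..b}" using ivQ kl by blast
    have ne: "k \<noteq> {}" "l \<noteq> {}" using kl p(1) Q(2) by auto
    show ?thesis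
      by (rule exI[of _ "max u u'"], rule exI[of _ "min v v'"]) (use k l ne in auto)
  qed
  \<comment> \<open>On pairs with a nondegenerate intersection, the map to the intersection is
    injective, so sums over pairs become sums over the family \<open>?D\<close> to which
    \<open>ac\<close> applies.\<close>
  let ?P = "{(k,l)\<in>p \<times> (Q-q). content (k \<inter> l) \<noteq> 0}"
  let ?i = "\<lambda>(k,l). k \<inter> l"
  let ?D = "?i ` ?P"
  have finP: "finite ?P" by (rule finite_subset[of _ "p \<times> Q"]) (use fin in auto)
  have int: "interior (k \<inter> l) \<inter> interior (k' \<inter> l') = {}"
    if "k \<in> p" "l \<in> Q" "k' \<in> p" "l' \<in> Q" "(k,l) \<noteq> (k',l')" for k l k' l'
  proof (cases "k = k'")
    case True
    then have "l \<noteq> l'" using that by auto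
    then have "interior l \<inter> interior l' = {}" using Q that by auto
    then show ?thesis by (auto simp: interior_Int)
  next
    case False
    then have "interior k \<inter> interior k' = {}" using p that by auto
    then show ?thesis by (auto simp: interior_Int)
  qed
  have inj: "inj_on ?i ?P"
  proof (rule inj_onI, rule ccontr)
    fix x y assume *: "x \<in> ?P" "y \<in> ?P" "?i x = ?i y" "x \<noteq> y"
    obtain k l k' l' where xy: "x = (k,l)" "y = (k',l')" by (cases x, cases y)
    have mem: "k \<in> p" "l \<in> Q" "k' \<in> p" "l' \<in> Q" using *(1,2) xy by auto
    have eq: "k \<inter> l = k' \<inter> l'" using *(3) xy by simp
    have "(k,l) \<noteq> (k',l')" using *(4) xy by simp
    from int[OF mem this] have "interior (k \<inter> l) = {}" unfolding eq by (simp only: Int_absorb)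
    moreover obtain u v where "k \<inter> l = {u..v}" using ivpQ mem by blast
    ultimately have "content (k \<inter> l) = 0" by (simp add: content_real_if)
    then show False using * xy by auto
  qed
  have cont: "content (k \<inter> l) = incr (\<lambda>x. x) (k \<inter> l)" if "k \<in> p" "l \<in> Q" for k l
    using ivpQ[OF that] content_eq_incr by metis
  have contp: "content k = incr (\<lambda>x. x) k" if "k \<in> p" for k
    using ivp[OF that] content_eq_incr by metis
  have red: "sum h (p \<times> (Q-q)) = sum h ?P"
    if "\<And>k l. k \<in> p \<Longrightarrow> l \<in> Q \<Longrightarrow> content (k \<inter> l) = 0 \<Longrightarrow> h (k,l) = 0" for h :: "_ \<Rightarrow> real"
    by (rule sum.mono_neutral_right) (use fin that in auto)
  have "sum content ?D = (\<Sum>x\<in>?P. content (?i x))"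
    using sum.reindex[OF inj, of content] by (simp only: comp_def)
  also have "\<dots> = (\<Sum>x\<in>p \<times> (Q-q). content (?i x))" by (rule red[symmetric]) auto
  also have "\<dots> = (\<Sum>(k,l)\<in>p \<times> (Q-q). incr (\<lambda>x. x) (k \<inter> l))"
    by (rule sum.cong) (auto simp: cont)
  also have "\<dots> = sum (incr (\<lambda>x. x)) p - (\<Sum>k\<in>p. \<Sum>l\<in>q. incr (\<lambda>x. x) (k \<inter> l))"
    by (rule split[symmetric])
  also have "\<dots> = sum content p - (\<Sum>k\<in>p. \<Sum>l\<in>q. content (k \<inter> l))"
  proof -
    have "sum (incr (\<lambda>x. x)) p = sum content p" by (rule sum.cong) (auto simp: contp)
    moreover have "(\<Sum>k\<in>p. \<Sum>l\<in>q. incr (\<lambda>x. x) (k \<inter> l)) = (\<Sum>k\<in>p. \<Sum>l\<in>q. content (k \<inter> l))"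
      by (intro sum.cong) (use cont Q in auto)
    ultimately show ?thesis by simp
  qed
  finally have cD: "sum content ?D < d" using small by simp
  have "(\<Sum>k\<in>?D. norm (incr f k)) < e"
  proof (rule ac[OF _ cD], unfold nonoverlapping_def, intro conjI ballI impI)
    show "finite ?D" using finP by auto
  next
    fix k assume "k \<in> ?D"
    then obtain k1 l1 where kl: "k = k1 \<inter> l1" "k1 \<in> p" "l1 \<in> Q" "content (k1 \<inter> l1) \<noteq> 0" by auto
    then have "a \<le> b" using ivp[OF kl(2)] p(1) by (auto simp: content_real_if split: if_splits)
    then show "\<exists>u v. k = {u..v} \<and> a \<le> u \<and> v \<le> b" using ivpQ kl by blast
  next
    fix k l assume *: "k \<in> ?D" "l \<in> ?D" "k \<noteq> l"
    then obtain k1 l1 k2 l2 where kl: "k = k1 \<inter> l1" "k1 \<in> p" "l1 \<in> Q" "l = k2 \<inter> l2" "k2 \<in> p" "l2 \<in> Q" by auto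
    have "(k1,l1) \<noteq> (k2,l2)" using kl *(3) by auto
    then show "interior k \<inter> interior l = {}" unfolding kl(1,4) by (rule int[OF kl(2,3,5,6)])
  qed
  moreover have "(\<Sum>k\<in>?D. norm (incr f k)) = (\<Sum>x\<in>?P. norm (incr f (?i x)))"
    using sum.reindex[OF inj, of "\<lambda>k. norm (incr f k)"] by (simp only: comp_def)
  moreover have "(\<Sum>x\<in>?P. norm (incr f (?i x))) = (\<Sum>x\<in>p \<times> (Q-q). norm (incr f (?i x)))"
  proof (rule red[symmetric])
    fix k l assume "k \<in> p" "l \<in> Q" "content (k \<inter> l) = 0"
    then show "norm (incr f (?i (k, l))) = 0" using ivpQ[of k l] incr_content_0 by fastforce
  qed
  moreover have "\<bar>\<Sum>(k,l)\<in>p \<times> (Q-q). incr f (k \<inter> l)\<bar> \<le> (\<Sum>x\<in>p \<times> (Q-q). norm (incr f (?i x)))"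
    by (rule order_trans[OF sum_abs]) (auto intro!: sum_mono)
  ultimately show ?thesis unfolding split by linarith
qed

section \<open>Vitali coverings and upper derivatives along intervals\<close>

text \<open>The Vitali theorem gives countably many disjoint intervals that cover \<open>E\<close>
  up to a null set, and finitely many of them already lose less than \<open>e\<close>. Confining
  them to \<open>U\<close> bounds their total length from above, which covering most of
  \<open>E\<close> does not.\<close>

lemma Vitali_finite_intervals:
  fixes E U :: "real set"
  assumes E: "E \<in> lmeasurable" and U: "open U" "U \<in> lmeasurable" "E \<subseteq> U" and e: "e > 0"
    and cover: "\<And>x d. x \<in> E \<Longrightarrow> d > 0 \<Longrightarrow> \<exists>u v. u \<le> x \<and> x \<le> v \<and> u < v \<and> v - u < d \<and> P u v"
  obtains p where "p division_of \<Union>p" "\<Union>p \<subseteq> U"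
    "\<forall>k\<in>p. \<exists>u v. u < v \<and> k = {u..v} \<and> P u v"
    "measure lebesgue (E \<inter> \<Union>p) > measure lebesgue E - e"
    "sum content p = measure lebesgue (\<Union>p)"
proof -
  let ?K = "{(u,v). u < v \<and> P u v \<and> {u..v} \<subseteq> U}"
  \<comment> \<open>Intervals are coded by their endpoints and presented to the covering theorem as
    balls around the midpoint.\<close>
  let ?a = "\<lambda>(u,v). (u + v) / 2 :: real" and ?r = "\<lambda>(u,v). (v - u) / 2 :: real"
  have cb: "cball (?a i) (?r i) = {fst i..snd i}" for i
    by (cases i) (simp add: cball_eq_atLeastAtMost field_simps)
  have S: "\<exists>i. i \<in> ?K \<and> x \<in> cball (?a i) (?r i) \<and> ?r i < d" if x: "x \<in> E" and d: "d > 0" for x d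
  proof -
    obtain s where s: "s > 0" "ball x s \<subseteq> U" using U x by (meson open_contains_ball subsetD)
    obtain u v where uv: "u \<le> x" "x \<le> v" "u < v" "v - u < min s d" "P u v"
      using cover[OF x, of "min s d"] s d by auto
    have "{u..v} \<subseteq> ball x s" using uv by (auto simp: dist_real_def)
    then have "(u,v) \<in> ?K" using s uv by auto
    moreover have "x \<in> cball (?a (u,v)) (?r (u,v))" unfolding cb using uv by simp
    moreover have "?r (u,v) < d" using uv by simp
    ultimately show ?thesis by blast
  qed
  have r: "0 < ?r i" if "i \<in> ?K" for i using that by auto
  obtain C where C: "countable C" "C \<subseteq> ?K"
     "pairwise (\<lambda>i j. disjnt (cball (?a i) (?r i)) (cball (?a j) (?r j))) C"
     "negligible (E - (\<Union>i \<in> C. cball (?a i) (?r i)))"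
    by (rule Vitali_covering_theorem_cballs[OF r S])
  let ?I = "\<lambda>i. {fst i..snd i} :: real set"
  have CU: "?I i \<subseteq> U" if "i \<in> C" for i
    using subsetD[OF C(2) that] by (cases i) simp
  \<comment> \<open>Cutting down to \<open>E\<close> keeps all finite unions below the measure of
    \<open>E\<close>, the bound that the approximation by finite subfamilies requires.\<close>
  let ?D = "(\<lambda>i. E \<inter> ?I i) ` C"
  have mD: "X \<in> lmeasurable" if "X \<in> ?D" for X
    using that by (auto intro: fmeasurable_Int_fmeasurable[OF E])
  have le: "measure lebesgue (\<Union>D') \<le> measure lebesgue E" if "D' \<subseteq> ?D" "finite D'" for D'
  proof (rule measure_mono_fmeasurable[OF _ _ E])
    show "\<Union>D' \<in> sets lebesgue" using that mD by (intro sets.finite_Union) (auto dest!: fmeasurableD)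
  qed (use that in auto)
  have "countable ?D" using C by auto
  then obtain D' where D': "D' \<subseteq> ?D" "finite D'" "measure lebesgue (\<Union>?D) - e < measure lebesgue (\<Union>D')"
    by (rule measure_countable_Union_approachable[OF _ e mD le])
  obtain C' where C': "C' \<subseteq> C" "finite C'" "D' = (\<lambda>i. E \<inter> ?I i) ` C'"
    using D' by (meson finite_subset_image)
  let ?p = "?I ` C'"
  have disj: "?I i \<inter> ?I j = {}" if "i \<in> C" "j \<in> C" "i \<noteq> j" for i j
    using C(3) that unfolding cb by (auto simp: pairwise_def disjnt_def)
  have lt: "fst i < snd i" "P (fst i) (snd i)" if "i \<in> C" for i
    using subsetD[OF C(2) that] by (cases i; simp)+
  have div: "?p division_of \<Union>?p"
  proof (rule division_ofI)
    fix k1 k2 assume "k1 \<in> ?p" "k2 \<in> ?p" "k1 \<noteq> k2"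
    then have "k1 \<inter> k2 = {}" using disj C' by blast
    then show "interior k1 \<inter> interior k2 = {}" using interior_subset by blast
  next
    fix k assume "k \<in> ?p"
    then show "\<exists>a b. k = cbox a b" by auto
    show "k \<noteq> {}" using \<open>k \<in> ?p\<close> lt C' by fastforce
  qed (use C' in auto)
  have "measure lebesgue (\<Union>?D) = measure lebesgue E"
  proof (rule measure_negligible_symdiff[OF E])
    have "(E - \<Union>?D) \<union> (\<Union>?D - E) = E - (\<Union>i \<in> C. cball (?a i) (?r i))" unfolding cb by auto
    then show "negligible ((E - \<Union>?D) \<union> (\<Union>?D - E))" using C(4) by simp
  qed
  moreover have "\<Union>D' = E \<inter> \<Union>?p" using C' by auto
  ultimately have m: "measure lebesgue (E \<inter> \<Union>?p) > measure lebesgue E - e" using D' by simp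
  show ?thesis
  proof (rule that[of ?p, OF div _ _ m])
    show "\<Union>?p \<subseteq> U" using CU C' by blast
    show "\<forall>k\<in>?p. \<exists>u v. u < v \<and> k = {u..v} \<and> P u v"
      using lt C' by blast
    have "sum content ?p = sum (measure lebesgue) ?p" by (rule sum.cong) auto
    then show "sum content ?p = measure lebesgue (\<Union>?p)"
      using content_division[OF div] by simp
  qed
qed

text \<open>
  Points at which the upper derivative along intervals shrinking to the point is, roughly, at least \<open>q\<close>.
  Requiring \<open>u < x < v\<close> strictly makes this a \<open>G\<^sub>\<delta>\<close> set.
\<close>

definition steep :: "real \<Rightarrow> real \<Rightarrow> (real \<Rightarrow> real) \<Rightarrow> real \<Rightarrow> real set" where
  "steep a b f q = {x. \<forall>d>0. \<exists>u v. a \<le> u \<and> u < x \<and> x < v \<and> v \<le> b \<and> v - u < d \<and> q * (v - u) < f v - f u}"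

lemma steep_subset: "steep a b f q \<subseteq> {a<..<b}"
proof
  fix x assume "x \<in> steep a b f q"
  then obtain u v where "a \<le> u \<and> u < x \<and> x < v \<and> v \<le> b \<and> v - u < 1 \<and> q * (v - u) < f v - f u"
    unfolding steep_def using zero_less_one by blast
  then show "x \<in> {a<..<b}" by auto
qed

lemma steep_lmeasurable: "steep a b f q \<in> lmeasurable"
proof -
  define G where "G n = \<Union>{{u<..<v} | u v. a \<le> u \<and> v \<le> b \<and> v - u < 1 / real (Suc n) \<and> q * (v - u) < f v - f u}" for n
  have "steep a b f q = (\<Inter>n. G n)"
  proof (intro set_eqI iffI)
    fix x assume x: "x \<in> steep a b f q"
    show "x \<in> (\<Inter>n. G n)"
    proof
      fix n
      have "1 / real (Suc n) > 0" by simp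
      then obtain u v where "a \<le> u \<and> u < x \<and> x < v \<and> v \<le> b \<and> v - u < 1 / real (Suc n) \<and> q * (v - u) < f v - f u"
        using x unfolding steep_def by blast
      then have "x \<in> {u<..<v}" "a \<le> u \<and> v \<le> b \<and> v - u < 1 / real (Suc n) \<and> q * (v - u) < f v - f u" by auto
      then show "x \<in> G n" unfolding G_def by blast
    qed
  next
    fix x assume x: "x \<in> (\<Inter>n. G n)"
    show "x \<in> steep a b f q"
      unfolding steep_def
    proof (intro CollectI allI impI)
      fix d :: real assume "d > 0"
      then obtain n where n: "1 / real (Suc n) < d" using nat_approx_posE by blast
      have "x \<in> G n" using x by blast
      then obtain u v where "x \<in> {u<..<v}" "a \<le> u \<and> v \<le> b \<and> v - u < 1 / real (Suc n) \<and> q * (v - u) < f v - f u"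
        unfolding G_def by blast
      then have "a \<le> u \<and> u < x \<and> x < v \<and> v \<le> b \<and> v - u < d \<and> q * (v - u) < f v - f u"
        using n by auto
      then show "\<exists>u v. a \<le> u \<and> u < x \<and> x < v \<and> v \<le> b \<and> v - u < d \<and> q * (v - u) < f v - f u" by blast
    qed
  qed
  moreover have "open (G n)" for n unfolding G_def by (rule open_Union) auto
  then have "(\<Inter>n. G n) \<in> sets borel" by (intro sets.countable_INT'') auto
  ultimately have "steep a b f q \<in> sets lebesgue" by simp
  moreover have "bounded (steep a b f q)" by (rule bounded_subset[OF _ steep_subset]) simp
  ultimately show ?thesis by (simp add: bounded_set_imp_lmeasurable)
qed

lemma steep_cover:
  assumes "x \<in> steep a b f q" "d > 0"
  shows "\<exists>u v. u \<le> x \<and> x \<le> v \<and> u < v \<and> v - u < d \<and> (a \<le> u \<and> v \<le> b \<and> q * (v - u) \<le> f v - f u)"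
proof -
  obtain u v where "a \<le> u \<and> u < x \<and> x < v \<and> v \<le> b \<and> v - u < d \<and> q * (v - u) < f v - f u"
    using assms unfolding steep_def by blast
  then have "u \<le> x \<and> x \<le> v \<and> u < v \<and> v - u < d \<and> (a \<le> u \<and> v \<le> b \<and> q * (v - u) \<le> f v - f u)" by auto
  then show ?thesis by blast
qed

lemma incr_uminus: "incr (\<lambda>x. - f x) k = - incr f k"
  by (simp add: incr_def)

lemma sum_incr_ge:
  assumes "\<forall>k\<in>p. \<exists>u v. u < v \<and> k = {u..v} \<and> (a \<le> u \<and> v \<le> b \<and> q * (v - u) \<le> f v - f u)"
  shows "q * sum content p \<le> sum (incr f) p"
  unfolding sum_distrib_left
proof (rule sum_mono)
  fix k assume "k \<in> p"
  then obtain u v where "u < v" "k = {u..v}" "q * (v - u) \<le> f v - f u" using assms by blast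
  then show "q * content k \<le> incr f k" by (simp add: incr_def)
qed

text \<open>
  Two finite Vitali families covering almost all of the same set differ by a set of small measure, so by
  absolute continuity the total increments of \<open>f\<close> over them are close; no monotone decomposition is needed.
\<close>

lemma negligible_steep_both:
  assumes f: "abs_cont_on a b f" and pq: "p < q"
  shows "negligible (steep a b f q \<inter> steep a b (\<lambda>x. - f x) (-p))"
proof (rule ccontr)
  \<comment> \<open>\<open>steep\<close> for \<open>- f\<close> at \<open>-p\<close> says that the
    lower derivative of \<open>f\<close> is roughly at most \<open>p\<close>: at every point of
    \<open>E\<close>, intervals of slope at least \<open>q\<close> and intervals of slope at most
    \<open>p < q\<close> both shrink to the point.\<close>
  define E where "E = steep a b f q \<inter> steep a b (\<lambda>x. - f x) (-p)"
  assume "\<not> negligible (steep a b f q \<inter> steep a b (\<lambda>x. - f x) (-p))"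
  moreover have E: "E \<in> lmeasurable" unfolding E_def by (intro fmeasurable.Int steep_lmeasurable)
  ultimately have pos: "measure lebesgue E > 0"
    using negligible_iff_measure0 unfolding E_def by (metis measure_nonneg order_le_less)
  define \<alpha> where "\<alpha> = measure lebesgue E"
  \<comment> \<open>A quarter of the gap \<open>(q - p) * \<alpha>\<close>: the final comparison
    loses \<open>2 * e\<close> by exchanging the two families and at most \<open>e\<close> by
    lengths that differ from \<open>\<alpha>\<close>, which is less than the gap.\<close>
  define e where "e = (q - p) * \<alpha> / 4"
  have e: "e > 0" using pos pq by (simp add: e_def \<alpha>_def)
  obtain d where d: "d > 0" and ac:
    "\<And>D. nonoverlapping a b D \<Longrightarrow> sum content D < d \<Longrightarrow> (\<Sum>k\<in>D. norm (incr f k)) < e"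
    using abs_cont_on_division[OF f e] by metis
  \<comment> \<open>The first bound keeps the part of each family outside the other, less than
    \<open>3 * \<epsilon>\<close> long, below \<open>d\<close>; the second makes the error
    \<open>(\<bar>p\<bar> + \<bar>q\<bar>) * \<epsilon>\<close> at most \<open>e\<close>.\<close>
  define \<epsilon> where "\<epsilon> = min (d / 4) (e / (\<bar>p\<bar> + \<bar>q\<bar> + 1))"
  have \<epsilon>: "\<epsilon> > 0" using d e by (simp add: \<epsilon>_def)
  obtain U where U: "open U" "E \<subseteq> U" "U - E \<in> lmeasurable" "emeasure lebesgue (U - E) < ennreal \<epsilon>"
    using sets_lebesgue_outer_open[OF fmeasurableD[OF E] \<epsilon>] by blast
  have UE: "U = E \<union> (U - E)" using U by auto
  have Um: "U \<in> lmeasurable" using fmeasurable.Un[OF E U(3)] UE by simp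
  have "measure lebesgue (U - E) < \<epsilon>" using U \<epsilon> by (simp add: emeasure_eq_measure2 ennreal_less_iff)
  moreover have "measure lebesgue U \<le> measure lebesgue E + measure lebesgue (U - E)"
    using measure_Un_le[OF fmeasurableD[OF E] fmeasurableD[OF U(3)]] UE by simp
  ultimately have Ule: "measure lebesgue U < \<alpha> + \<epsilon>" by (simp add: \<alpha>_def)
  have c1: "\<exists>u v. u \<le> x \<and> x \<le> v \<and> u < v \<and> v - u < d \<and> (a \<le> u \<and> v \<le> b \<and> q * (v - u) \<le> f v - f u)"
    if "x \<in> E" "d > 0" for x d using that by (intro steep_cover) (auto simp: E_def)
  have c2: "\<exists>u v. u \<le> x \<and> x \<le> v \<and> u < v \<and> v - u < d \<and> (a \<le> u \<and> v \<le> b \<and> (-p) * (v - u) \<le> - f v - (- f u))"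
    if "x \<in> E" "d > 0" for x d using that by (intro steep_cover) (auto simp: E_def)
  obtain I where I: "I division_of \<Union>I" "\<Union>I \<subseteq> U"
    "\<forall>k\<in>I. \<exists>u v. u < v \<and> k = {u..v} \<and> (a \<le> u \<and> v \<le> b \<and> q * (v - u) \<le> f v - f u)"
    "measure lebesgue (E \<inter> \<Union>I) > measure lebesgue E - \<epsilon>"
    "sum content I = measure lebesgue (\<Union>I)"
    by (rule Vitali_finite_intervals[OF E U(1) Um U(2) \<epsilon> c1])
  obtain J where J: "J division_of \<Union>J" "\<Union>J \<subseteq> U"
    "\<forall>k\<in>J. \<exists>u v. u < v \<and> k = {u..v} \<and> (a \<le> u \<and> v \<le> b \<and> (-p) * (v - u) \<le> - f v - (- f u))"
    "measure lebesgue (E \<inter> \<Union>J) > measure lebesgue E - \<epsilon>"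
    "sum content J = measure lebesgue (\<Union>J)"
    by (rule Vitali_finite_intervals[OF E U(1) Um U(2) \<epsilon> c2])
  have mI: "\<Union>I \<in> lmeasurable" "\<Union>J \<in> lmeasurable" using I J by (auto intro: lmeasurable_division)
  have upper: "sum content I < \<alpha> + \<epsilon>" "sum content J < \<alpha> + \<epsilon>"
    using measure_mono_fmeasurable[OF I(2) fmeasurableD[OF mI(1)] Um] measure_mono_fmeasurable[OF J(2) fmeasurableD[OF mI(2)] Um]
      Ule I(5) J(5) by linarith+
  have "measure lebesgue (E \<inter> \<Union>I) \<le> measure lebesgue (\<Union>I)"
    by (rule measure_mono_fmeasurable[OF Int_lower2 fmeasurableD[OF fmeasurable.Int[OF E mI(1)]] mI(1)])
  moreover have "measure lebesgue (E \<inter> \<Union>J) \<le> measure lebesgue (\<Union>J)"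
    by (rule measure_mono_fmeasurable[OF Int_lower2 fmeasurableD[OF fmeasurable.Int[OF E mI(2)]] mI(2)])
  ultimately have lower: "sum content I > \<alpha> - \<epsilon>" "sum content J > \<alpha> - \<epsilon>"
    using I(4,5) J(4,5) unfolding \<alpha>_def by linarith+
  \<comment> \<open>Each family misses less than \<open>\<epsilon>\<close> of \<open>E\<close>, so
    by inclusion-exclusion inside \<open>E\<close> they share more than
    \<open>\<alpha> - 2 * \<epsilon>\<close>.\<close>
  have common: "(\<Sum>k\<in>I. \<Sum>l\<in>J. content (k \<inter> l)) > \<alpha> - 2 * \<epsilon>"
  proof -
    have fin: "finite (I \<times> J)" using I(1) J(1) by auto
    have ivl: "\<exists>u v. k \<inter> l = {u..v}" if kl: "k \<in> I" "l \<in> J" for k l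
    proof -
      obtain u v where "k = {u..v}" using bspec[OF I(3) kl(1)] by (elim exE conjE) (rule that)
      moreover obtain u' v' where "l = {u'..v'}" using bspec[OF J(3) kl(2)] by (elim exE conjE) (rule that)
      ultimately show ?thesis by auto
    qed
    have un: "(\<Union>x\<in>I \<times> J. fst x \<inter> snd x) = \<Union>I \<inter> \<Union>J" by auto
    have "measure lebesgue (\<Union>x\<in>I \<times> J. fst x \<inter> snd x) \<le> (\<Sum>x\<in>I \<times> J. measure lebesgue (fst x \<inter> snd x))"
    proof (rule measure_UNION_le[OF fin])
      fix x assume "x \<in> I \<times> J"
      then obtain u v where "fst x \<inter> snd x = {u..v}" using ivl by (metis mem_Times_iff)
      then show "fst x \<inter> snd x \<in> sets lebesgue" by simp
    qed
    also have "\<dots> = (\<Sum>x\<in>I \<times> J. content (fst x \<inter> snd x))"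
    proof (rule sum.cong[OF refl])
      fix x assume "x \<in> I \<times> J"
      then obtain u v where "fst x \<inter> snd x = {u..v}" using ivl by (metis mem_Times_iff)
      then show "measure lebesgue (fst x \<inter> snd x) = content (fst x \<inter> snd x)" by simp
    qed
    also have "\<dots> = (\<Sum>k\<in>I. \<Sum>l\<in>J. content (k \<inter> l))"
      by (simp add: sum.cartesian_product case_prod_unfold)
    finally have 1: "measure lebesgue (\<Union>I \<inter> \<Union>J) \<le> (\<Sum>k\<in>I. \<Sum>l\<in>J. content (k \<inter> l))" unfolding un .
    let ?A = "E \<inter> \<Union>I" and ?B = "E \<inter> \<Union>J"
    have mAB: "?A \<in> lmeasurable" "?B \<in> lmeasurable" using E mI by (auto intro: fmeasurable.Int)
    have "measure lebesgue (?A \<union> ?B) = measure lebesgue ?A + measure lebesgue ?B - measure lebesgue (?A \<inter> ?B)"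
      using measure_Un3[OF mAB] .
    moreover have "measure lebesgue (?A \<union> ?B) \<le> \<alpha>"
      unfolding \<alpha>_def by (rule measure_mono_fmeasurable[OF _ _ E]) (use fmeasurable.Un[OF mAB] in \<open>auto dest: fmeasurableD\<close>)
    moreover have "measure lebesgue (?A \<inter> ?B) \<le> measure lebesgue (\<Union>I \<inter> \<Union>J)"
      by (rule measure_mono_fmeasurable) (use fmeasurable.Int[OF mAB] fmeasurable.Int[OF mI] in \<open>auto dest: fmeasurableD\<close>)
    ultimately show ?thesis using 1 I(4) J(4) unfolding \<alpha>_def by linarith
  qed
  have ab: "\<Union>I \<subseteq> {a..b}" "\<Union>J \<subseteq> {a..b}"
  proof -
    show "\<Union>I \<subseteq> {a..b}"
    proof (rule Union_least)
      fix k assume k: "k \<in> I"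
      obtain u v where "k = {u..v}" "a \<le> u" "v \<le> b"
        using bspec[OF I(3) k] by (elim exE conjE) (rule that)
      then show "k \<subseteq> {a..b}" by auto
    qed
    show "\<Union>J \<subseteq> {a..b}"
    proof (rule Union_least)
      fix k assume k: "k \<in> J"
      obtain u v where "k = {u..v}" "a \<le> u" "v \<le> b"
        using bspec[OF J(3) k] by (elim exE conjE) (rule that)
      then show "k \<subseteq> {a..b}" by auto
    qed
  qed
  have ed: "\<epsilon> \<le> d / 4" unfolding \<epsilon>_def by (rule min.cobounded1)
  have "\<bar>sum (incr f) I - (\<Sum>k\<in>I. \<Sum>l\<in>J. incr f (k \<inter> l))\<bar> < e"
  proof (rule incr_Int_close[OF ac I(1) ab(1) J(1) ab(2)])
    show "sum content I - (\<Sum>k\<in>I. \<Sum>l\<in>J. content (k \<inter> l)) < d" using common upper ed d by linarith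
  qed
  moreover have "\<bar>sum (incr f) J - (\<Sum>k\<in>J. \<Sum>l\<in>I. incr f (k \<inter> l))\<bar> < e"
  proof (rule incr_Int_close[OF ac J(1) ab(2) I(1) ab(1)])
    have "(\<Sum>k\<in>J. \<Sum>l\<in>I. content (k \<inter> l)) = (\<Sum>k\<in>I. \<Sum>l\<in>J. content (k \<inter> l))"
      by (subst sum.swap) (simp add: Int_commute)
    then show "sum content J - (\<Sum>k\<in>J. \<Sum>l\<in>I. content (k \<inter> l)) < d" using common upper ed d by linarith
  qed
  moreover have "(\<Sum>k\<in>J. \<Sum>l\<in>I. incr f (k \<inter> l)) = (\<Sum>k\<in>I. \<Sum>l\<in>J. incr f (k \<inter> l))"
    by (subst sum.swap) (simp add: Int_commute)
  ultimately have close: "sum (incr f) I - sum (incr f) J < 2 * e" by linarith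
  have qI: "q * sum content I \<le> sum (incr f) I" by (rule sum_incr_ge[OF I(3)])
  have "(-p) * sum content J \<le> sum (incr (\<lambda>x. - f x)) J" by (rule sum_incr_ge[OF J(3)])
  then have pJ: "sum (incr f) J \<le> p * sum content J" by (simp add: incr_uminus sum_negf)
  have "\<bar>q * sum content I - q * \<alpha>\<bar> \<le> \<bar>q\<bar> * \<epsilon>"
    unfolding right_diff_distrib[symmetric] abs_mult by (rule mult_left_mono) (use upper lower in auto)
  moreover have "\<bar>p * sum content J - p * \<alpha>\<bar> \<le> \<bar>p\<bar> * \<epsilon>"
    unfolding right_diff_distrib[symmetric] abs_mult by (rule mult_left_mono) (use upper lower in auto)
  ultimately have "q * \<alpha> - p * \<alpha> \<le> 2 * e + (\<bar>p\<bar> + \<bar>q\<bar>) * \<epsilon>"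
    using close qI pJ by (simp add: algebra_simps)
  moreover have "(\<bar>p\<bar> + \<bar>q\<bar>) * \<epsilon> \<le> e"
  proof -
    have "(\<bar>p\<bar> + \<bar>q\<bar>) * \<epsilon> \<le> (\<bar>p\<bar> + \<bar>q\<bar> + 1) * (e / (\<bar>p\<bar> + \<bar>q\<bar> + 1))"
      by (rule mult_mono) (use \<epsilon> in \<open>auto simp: \<epsilon>_def\<close>)
    then show ?thesis by (simp split: if_splits)
  qed
  moreover have "q * \<alpha> - p * \<alpha> = 4 * e" by (simp add: e_def algebra_simps)
  ultimately show False using e by linarith
qed

text \<open>If the set had positive measure \<open>\<alpha>\<close> near some point, finitely many
  short intervals of slope at least \<open>n\<close> would cover half of that part, with increments
  adding up to at least \<open>n * \<alpha> / 2\<close>; absolute continuity caps them by 1,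
  uniformly in \<open>n\<close>.\<close>

lemma negligible_steep_infinite:
  assumes f: "abs_cont_on a b f"
  shows "negligible (\<Inter>n::nat. steep a b f (real n))"
proof -
  define E where "E = (\<Inter>n::nat. steep a b f (real n))"
  have "E \<in> sets lebesgue"
    unfolding E_def by (rule sets.countable_INT'') (auto intro: fmeasurableD steep_lmeasurable)
  moreover have "bounded E"
    by (rule bounded_subset[OF _ subset_trans[OF _ steep_subset[of a b f "real 0"]]]) (auto simp: E_def simp del: of_nat_0)
  ultimately have E: "E \<in> lmeasurable" by (simp add: bounded_set_imp_lmeasurable)
  obtain d where d: "d > 0" and ac:
    "\<And>D. nonoverlapping a b D \<Longrightarrow> sum content D < d \<Longrightarrow> (\<Sum>k\<in>D. norm (incr f k)) < 1"
    using abs_cont_on_division[OF f zero_less_one] by metis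
  \<comment> \<open>This ball has length \<open>2 * d / 3\<close>, so every nonoverlapping family
    inside it is short enough for \<open>ac\<close>.\<close>
  have "negligible (E \<inter> ball x (d / 3))" for x
  proof (rule ccontr)
    let ?F = "E \<inter> ball x (d / 3)"
    assume neg: "\<not> negligible ?F"
    have F: "?F \<in> lmeasurable" using E by (intro fmeasurable.Int) auto
    define \<alpha> where "\<alpha> = measure lebesgue ?F"
    have \<alpha>: "\<alpha> > 0" using neg F negligible_iff_measure0 unfolding \<alpha>_def by (metis measure_nonneg order_le_less)
    obtain n :: nat where n: "real n > 2 / \<alpha>" using reals_Archimedean2 by blast
    have c: "\<exists>u v. u \<le> y \<and> y \<le> v \<and> u < v \<and> v - u < s \<and> (a \<le> u \<and> v \<le> b \<and> real n * (v - u) \<le> f v - f u)"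
      if "y \<in> ?F" "s > 0" for y s using that by (intro steep_cover) (auto simp: E_def)
    obtain p where p: "p division_of \<Union>p" "\<Union>p \<subseteq> ball x (d / 3)"
      "\<forall>k\<in>p. \<exists>u v. u < v \<and> k = {u..v} \<and> (a \<le> u \<and> v \<le> b \<and> real n * (v - u) \<le> f v - f u)"
      "measure lebesgue (?F \<inter> \<Union>p) > measure lebesgue ?F - \<alpha> / 2"
      "sum content p = measure lebesgue (\<Union>p)"
      by (rule Vitali_finite_intervals[OF F open_ball _ _ _ c, where e = "\<alpha> / 2"]) (use \<alpha> in auto)
    have mp: "\<Union>p \<in> lmeasurable" using p(1) by (rule lmeasurable_division)
    have "measure lebesgue (\<Union>p) \<le> measure lebesgue (ball x (d / 3))"
      by (rule measure_mono_fmeasurable[OF p(2) fmeasurableD[OF mp]]) simp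
    also have "\<dots> < d" using d by (simp add: ball_eq_greaterThanLessThan)
    finally have "sum content p < d" using p(5) by simp
    moreover have "nonoverlapping a b p"
      unfolding nonoverlapping_def using p(1,3) by (meson division_of_def)
    ultimately have "(\<Sum>k\<in>p. norm (incr f k)) < 1" using ac by blast
    moreover have "sum (incr f) p \<le> (\<Sum>k\<in>p. norm (incr f k))" by (rule sum_mono) auto
    moreover have "real n * sum content p \<le> sum (incr f) p" by (rule sum_incr_ge[OF p(3)])
    moreover have "real n * sum content p \<ge> 1"
    proof -
      have "measure lebesgue (?F \<inter> \<Union>p) \<le> measure lebesgue (\<Union>p)"
        by (rule measure_mono_fmeasurable[OF _ _ mp]) (use fmeasurable.Int[OF F mp] in \<open>auto dest: fmeasurableD\<close>)
      then have "sum content p \<ge> \<alpha> / 2" using p(4,5) unfolding \<alpha>_def by simp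
      then have "real n * sum content p \<ge> (2 / \<alpha>) * (\<alpha> / 2)"
        using n \<alpha> by (intro mult_mono) auto
      then show ?thesis using \<alpha> by simp
    qed
    ultimately show False by linarith
  qed
  \<comment> \<open>By the Lindelof property, a set that is negligible near each of its points is
    negligible.\<close>
  then have "\<exists>U. openin (top_of_set E) U \<and> x \<in> U \<and> negligible U" if "x \<in> E" for x
    using that d by (intro exI[of _ "E \<inter> ball x (d / 3)"]) (auto simp: openin_open_Int)
  then show ?thesis using locally_negligible_alt unfolding E_def by blast
qed

lemma steep_antimono: "p \<le> q \<Longrightarrow> steep a b f q \<subseteq> steep a b f p"
proof
  fix x assume pq: "p \<le> q" and x: "x \<in> steep a b f q"
  show "x \<in> steep a b f p"
    unfolding steep_def
  proof (intro CollectI allI impI)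
    fix d :: real assume "d > 0"
    then obtain u v where uv: "a \<le> u \<and> u < x \<and> x < v \<and> v \<le> b \<and> v - u < d \<and> q * (v - u) < f v - f u"
      using x unfolding steep_def by blast
    moreover have "p * (v - u) \<le> q * (v - u)" using uv pq by (intro mult_right_mono) auto
    ultimately have "a \<le> u \<and> u < x \<and> x < v \<and> v \<le> b \<and> v - u < d \<and> p * (v - u) < f v - f u" by linarith
    then show "\<exists>u v. a \<le> u \<and> u < x \<and> x < v \<and> v \<le> b \<and> v - u < d \<and> p * (v - u) < f v - f u" by blast
  qed
qed

text \<open>\<open>steep\<close> sees only intervals with \<open>x\<close> in the interior. Widening
  \<open>{u..v}\<close> by \<open>t\<close> on both sides and letting \<open>t\<close> tend to 0
  extends the bound to intervals that have \<open>x\<close> as an endpoint, which one-sided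
  difference quotients require.\<close>

lemma not_steep_bound:
  assumes x: "x \<notin> steep a b f q" "a < x" "x < b" and cont: "continuous_on {a..b} f"
  obtains d where "d > 0" "\<And>u v. u \<le> x \<Longrightarrow> x \<le> v \<Longrightarrow> v - u < d \<Longrightarrow> a < u \<and> v < b \<and> f v - f u \<le> q * (v - u)"
proof -
  obtain d where d: "d > 0" and nd': "\<forall>u v. \<not> (a \<le> u \<and> u < x \<and> x < v \<and> v \<le> b \<and> v - u < d \<and> q * (v - u) < f v - f u)"
    using x(1) unfolding steep_def by (simp only: mem_Collect_eq not_all not_imp not_ex) blast
  have nd: "f v - f u \<le> q * (v - u)" if "a \<le> u" "u < x" "x < v" "v \<le> b" "v - u < d" for u v
    using nd' that not_less by blast
  \<comment> \<open>Besides staying below \<open>d\<close>, intervals around \<open>x\<close>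
    shorter than \<open>s\<close> lie strictly inside \<open>{a<..<b}\<close>, where
    \<open>f\<close> is continuous from both sides.\<close>
  define s where "s = min d (min (x - a) (b - x))"
  have s: "s > 0" using d x by (simp add: s_def)
  show ?thesis
  proof (rule that[OF s], intro conjI)
    fix u v assume uv: "u \<le> x" "x \<le> v" "v - u < s"
    show au: "a < u" and vb: "v < b" using uv by (auto simp: s_def)
    let ?F = "at_right (0::real)"
    have ev: "\<forall>\<^sub>F t in ?F. f (v + t) - f (u - t) \<le> q * ((v + t) - (u - t))"
    proof -
      have "\<forall>\<^sub>F t in ?F. t \<in> {0<..<min (min (u - a) (b - v)) ((s - (v - u)) / 2)}"
        by (rule eventually_at_right_real) (use uv au vb in auto)
      then show ?thesis
      proof eventually_elim
        case (elim t)
        then have t: "0 < t" "t < u - a" "t < b - v" "t < (s - (v - u)) / 2" by auto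
        then have "(v + t) - (u - t) < d" by (auto simp: s_def)
        then show ?case using t uv by (intro nd) auto
      qed
    qed
    have ct: "isCont f y" if "a < y" "y < b" for y
      using continuous_on_interior[OF cont, of y] that by simp
    have lim: "((\<lambda>t. f (v + t) - f (u - t)) \<longlongrightarrow> f v - f u) ?F"
    proof (rule tendsto_diff)
      show "((\<lambda>t. f (v + t)) \<longlongrightarrow> f v) ?F"
        by (rule isCont_tendsto_compose[OF ct]) (use vb au uv in \<open>auto intro!: tendsto_eq_intros\<close>)
      show "((\<lambda>t. f (u - t)) \<longlongrightarrow> f u) ?F"
        by (rule isCont_tendsto_compose[OF ct]) (use vb au uv in \<open>auto intro!: tendsto_eq_intros\<close>)
    qed
    have "((\<lambda>t. q * ((v + t) - (u - t))) \<longlongrightarrow> q * ((v + 0) - (u - 0))) ?F"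
      by (intro tendsto_intros)
    then show "f v - f u \<le> q * (v - u)"
      using tendsto_le[OF _ _ lim ev] by simp
  qed
qed

lemma abs_cont_on_imp_continuous_on:
  assumes "abs_cont_on a b f" shows "continuous_on {a..b} f"
  unfolding continuous_on_iff
proof (intro ballI allI impI)
  fix x e :: real assume x: "x \<in> {a..b}" and e: "e > 0"
  obtain d where d: "d > 0" and ac:
    "\<And>D. nonoverlapping a b D \<Longrightarrow> sum content D < d \<Longrightarrow> (\<Sum>k\<in>D. norm (incr f k)) < e"
    using abs_cont_on_division[OF assms e] by metis
  have key: "norm (f v - f u) < e" if "a \<le> u" "u \<le> v" "v \<le> b" "v - u < d" for u v
    using ac[of "{{u..v}}"] that by (auto simp: nonoverlapping_def incr_def)
  show "\<exists>d>0. \<forall>y\<in>{a..b}. dist y x < d \<longrightarrow> dist (f y) (f x) < e"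
  proof (intro exI[of _ d] conjI ballI impI d)
    fix y assume y: "y \<in> {a..b}" "dist y x < d"
    show "dist (f y) (f x) < e"
    proof (cases "x \<le> y")
      case True then show ?thesis using key[of x y] x y by (auto simp: dist_norm)
    next
      case False then show ?thesis using key[of y x] x y by (auto simp: dist_norm norm_minus_commute)
    qed
  qed
qed

lemma abs_cont_on_uminus: "abs_cont_on a b f \<Longrightarrow> abs_cont_on a b (\<lambda>x. - f x)"
  unfolding abs_cont_on_def by (simp add: norm_minus_commute)

text \<open>The derivative at \<open>x\<close> is the supremum \<open>L\<close> of all
  \<open>q\<close> with \<open>x\<close> in \<open>steep a b f q\<close>. The slope bounds for
  \<open>f\<close> and \<open>- f\<close> make it finite, and excluding rational gaps keeps slopes
  of short intervals from dropping below \<open>L - e\<close>.\<close>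

lemma abs_cont_on_differentiable_ae_real:
  fixes f :: "real \<Rightarrow> real"
  assumes f: "abs_cont_on a b f"
  shows "negligible {x \<in> {a<..<b}. \<not> f differentiable (at x)}"
proof -
  let ?g = "\<lambda>x. - f x"
  have g: "abs_cont_on a b ?g" by (rule abs_cont_on_uminus[OF f])
  have cf: "continuous_on {a..b} f" and cg: "continuous_on {a..b} ?g"
    using f g by (auto intro: abs_cont_on_imp_continuous_on)
  let ?R = "{(p,q). p \<in> \<rat> \<and> q \<in> \<rat> \<and> p < q} :: (real \<times> real) set"
  \<comment> \<open>The exceptional points: upper derivative infinite, lower derivative minus
    infinity, or a rational gap between lower and upper derivative.\<close>
  define N where "N = (\<Inter>n::nat. steep a b f (real n)) \<union> (\<Inter>n::nat. steep a b ?g (real n)) \<union>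
    (\<Union>x\<in>?R. steep a b f (snd x) \<inter> steep a b ?g (- fst x))"
  have "countable ?R"
    by (rule countable_subset[of _ "\<rat> \<times> \<rat>"]) (auto simp: countable_rat)
  then have N: "negligible N"
    unfolding N_def using negligible_steep_infinite[OF f] negligible_steep_infinite[OF g] negligible_steep_both[OF f]
    by (intro negligible_Un negligible_countable_Union) auto
  have "f differentiable (at x)" if x: "a < x" "x < b" "x \<notin> N" for x
  proof -
    obtain n where n: "x \<notin> steep a b f (real n)" using x(3) by (auto simp: N_def)
    obtain m where m: "x \<notin> steep a b ?g (real m)" using x(3) by (auto simp: N_def)
    define S where "S = {q. x \<in> steep a b f q}"
    obtain d where d: "d > 0" "\<And>u v. u \<le> x \<Longrightarrow> x \<le> v \<Longrightarrow> v - u < d \<Longrightarrow> a < u \<and> v < b \<and> - f v - (- f u) \<le> real m * (v - u)"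
      using not_steep_bound[OF m x(1,2) cg] by metis
    \<comment> \<open>The bound for \<open>- f\<close> only gives slopes at least
      \<open>- real m\<close>; subtracting 1 makes the inequality strict, as \<open>steep\<close>
      demands.\<close>
    have "- real m - 1 \<in> S"
      unfolding S_def steep_def
    proof (intro CollectI allI impI)
      fix e :: real assume e: "e > 0"
      define r where "r = min d e / 3"
      have r: "r > 0" "2 * r < d" "2 * r < e" using d e by (auto simp: r_def)
      have "a < x - r \<and> x + r < b \<and> - f (x + r) - (- f (x - r)) \<le> real m * ((x + r) - (x - r))"
        using r by (intro d(2)) auto
      then have "a \<le> x - r \<and> x - r < x \<and> x < x + r \<and> x + r \<le> b \<and> (x + r) - (x - r) < e \<and>
          (- real m - 1) * ((x + r) - (x - r)) < f (x + r) - f (x - r)"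
        using r by (auto simp: algebra_simps)
      then show "\<exists>u v. a \<le> u \<and> u < x \<and> x < v \<and> v \<le> b \<and> v - u < e \<and> (- real m - 1) * (v - u) < f v - f u" by blast
    qed
    then have ne: "S \<noteq> {}" by auto
    have bdd: "bdd_above S"
    proof (rule bdd_aboveI)
      fix q assume "q \<in> S"
      then show "q \<le> real n" using n steep_antimono[of "real n" q a b f] by (fastforce simp: S_def)
    qed
    define L where "L = Sup S"
    have straddle: "\<exists>d>0. \<forall>u v. u \<le> x \<longrightarrow> x \<le> v \<longrightarrow> v - u < d \<longrightarrow> \<bar>f v - f u - L * (v - u)\<bar> \<le> e * (v - u)" if e: "e > 0" for e
    proof -
      have "L + e \<notin> S" using cSup_upper[OF _ bdd, of "L + e"] e by (auto simp: L_def)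
      then have "x \<notin> steep a b f (L + e)" by (simp add: S_def)
      then obtain d1 where d1: "d1 > 0" "\<And>u v. u \<le> x \<Longrightarrow> x \<le> v \<Longrightarrow> v - u < d1 \<Longrightarrow> a < u \<and> v < b \<and> f v - f u \<le> (L + e) * (v - u)"
        using not_steep_bound[OF _ x(1,2) cf] by metis
      obtain q where q: "q \<in> S" "L - e < q" using less_cSupD[OF ne, of "L - e"] e by (auto simp: L_def)
      \<comment> \<open>\<open>N\<close> excludes rational pairs only, so two rationals are placed
        between \<open>L - e\<close> and \<open>q\<close>: \<open>f\<close> is steep at
        \<open>x\<close> for \<open>q'\<close>, hence \<open>- f\<close> cannot be steep there for
        \<open>- p\<close>.\<close>
      obtain q' where q': "q' \<in> \<rat>" "L - e < q'" "q' < q" using Rats_dense_in_real[OF q(2)] by blast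
      obtain p where p: "p \<in> \<rat>" "L - e < p" "p < q'" using Rats_dense_in_real[OF q'(2)] by blast
      have "x \<in> steep a b f q'" using steep_antimono[of q' q a b f] q q' by (auto simp: S_def)
      then have "x \<notin> steep a b ?g (- p)" using x(3) p q' unfolding N_def by fastforce
      then obtain d2 where d2: "d2 > 0" "\<And>u v. u \<le> x \<Longrightarrow> x \<le> v \<Longrightarrow> v - u < d2 \<Longrightarrow> a < u \<and> v < b \<and> - f v - (- f u) \<le> (- p) * (v - u)"
        using not_steep_bound[OF _ x(1,2) cg] by metis
      show ?thesis
      proof (intro exI[of _ "min d1 d2"] conjI allI impI)
        fix u v assume uv: "u \<le> x" "x \<le> v" "v - u < min d1 d2"
        have "f v - f u \<le> (L + e) * (v - u)" using d1(2)[of u v] uv by auto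
        moreover have "- f v - (- f u) \<le> (- p) * (v - u)" using d2(2)[of u v] uv by auto
        moreover have "(L - e) * (v - u) \<le> p * (v - u)" using p uv by (intro mult_right_mono) auto
        ultimately show "\<bar>f v - f u - L * (v - u)\<bar> \<le> e * (v - u)" by (simp add: algebra_simps abs_le_iff)
      qed (use d1 d2 in auto)
    qed
    have "(f has_derivative (\<lambda>h. L * h)) (at x)"
      unfolding has_derivative_at_alt
    proof (intro conjI allI impI)
      fix e :: real assume "e > 0"
      then obtain d where d: "d > 0" "\<And>u v. u \<le> x \<Longrightarrow> x \<le> v \<Longrightarrow> v - u < d \<Longrightarrow> \<bar>f v - f u - L * (v - u)\<bar> \<le> e * (v - u)"
        using straddle by blast
      show "\<exists>d>0. \<forall>y. norm (y - x) < d \<longrightarrow> norm (f y - f x - L * (y - x)) \<le> e * norm (y - x)"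
      proof (intro exI[of _ d] conjI allI impI d(1))
        fix y assume y: "norm (y - x) < d"
        show "norm (f y - f x - L * (y - x)) \<le> e * norm (y - x)"
        proof (cases "x \<le> y")
          case True then show ?thesis using d(2)[of x y] y by auto
        next
          case False
          then have "\<bar>f x - f y - L * (x - y)\<bar> \<le> e * (x - y)" using d(2)[of y x] y by auto
          then show ?thesis using False by (simp add: algebra_simps abs_le_iff)
        qed
      qed
    qed (auto intro: bounded_linear_mult_right)
    then show ?thesis by (auto simp: differentiable_def)
  qed
  then have "{x \<in> {a<..<b}. \<not> f differentiable (at x)} \<subseteq> N" by auto
  then show ?thesis using N negligible_subset by blast
qed

lemma abs_cont_on_inner:
  fixes f :: "real \<Rightarrow> 'a::real_inner"
  assumes "abs_cont_on a b f" "norm i \<le> 1"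
  shows "abs_cont_on a b (\<lambda>x. f x \<bullet> i)"
  unfolding abs_cont_on_def
proof (intro allI impI)
  fix e :: real assume "e > 0"
  from assms(1)[unfolded abs_cont_on_def, rule_format, OF this]
  obtain d where d: "d > 0" and ac: "\<forall>(N::nat) (u::nat \<Rightarrow> real) v.
        (\<forall>i<N. a \<le> u i \<and> u i \<le> v i \<and> v i \<le> b) \<and>
        (\<forall>i<N. \<forall>j<N. i \<noteq> j \<longrightarrow> v i \<le> u j \<or> v j \<le> u i) \<and>
        (\<Sum>i<N. v i - u i) < d
        \<longrightarrow> (\<Sum>i<N. norm (f (v i) - f (u i))) < e" by (elim exE conjE) (rule that)
  show "\<exists>d>0. \<forall>(N::nat) (u::nat \<Rightarrow> real) v.
        (\<forall>i<N. a \<le> u i \<and> u i \<le> v i \<and> v i \<le> b) \<and>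
        (\<forall>i<N. \<forall>j<N. i \<noteq> j \<longrightarrow> v i \<le> u j \<or> v j \<le> u i) \<and>
        (\<Sum>i<N. v i - u i) < d
        \<longrightarrow> (\<Sum>j<N. norm (f (v j) \<bullet> i - f (u j) \<bullet> i)) < e"
  proof (intro exI[of _ d] conjI allI impI d)
    fix N and u v :: "nat \<Rightarrow> real"
    assume h: "(\<forall>i<N. a \<le> u i \<and> u i \<le> v i \<and> v i \<le> b) \<and>
        (\<forall>i<N. \<forall>j<N. i \<noteq> j \<longrightarrow> v i \<le> u j \<or> v j \<le> u i) \<and>
        (\<Sum>i<N. v i - u i) < d"
    have "(\<Sum>j<N. norm (f (v j) \<bullet> i - f (u j) \<bullet> i)) \<le> (\<Sum>i<N. norm (f (v i) - f (u i)))"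
    proof (rule sum_mono)
      fix j
      have "norm ((f (v j) - f (u j)) \<bullet> i) \<le> norm (f (v j) - f (u j)) * norm i" by (simp add: Cauchy_Schwarz_ineq2)
      also have "\<dots> \<le> norm (f (v j) - f (u j))" using assms(2) by (simp add: mult_left_le)
      finally show "norm (f (v j) \<bullet> i - f (u j) \<bullet> i) \<le> norm (f (v j) - f (u j))" by (simp add: inner_diff_left)
    qed
    also have "\<dots> < e" by (rule ac[rule_format, OF h])
    finally show "(\<Sum>j<N. norm (f (v j) \<bullet> i - f (u j) \<bullet> i)) < e" .
  qed
qed

theorem abs_cont_on_differentiable_ae:
  fixes f :: "real \<Rightarrow> 'a::euclidean_space"
  assumes f: "abs_cont_on a b f"
  shows "negligible {x \<in> {a<..<b}. \<not> f differentiable (at x)}"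
proof -
  have "{x \<in> {a<..<b}. \<not> f differentiable (at x)} = (\<Union>i\<in>Basis. {x \<in> {a<..<b}. \<not> (\<lambda>x. f x \<bullet> i) differentiable (at x)})"
    using differentiable_componentwise_within[of f _ UNIV] by auto
  moreover have "negligible {x \<in> {a<..<b}. \<not> (\<lambda>x. f x \<bullet> i) differentiable (at x)}" if "i \<in> Basis" for i
    using that by (intro abs_cont_on_differentiable_ae_real abs_cont_on_inner[OF f]) auto
  ultimately show ?thesis by (auto intro!: negligible_Union)
qed

lemma abs_cont_on_subset:
  assumes "abs_cont_on a b f" "a \<le> c" "d \<le> b"
  shows "abs_cont_on c d f"
  unfolding abs_cont_on_def
proof (intro allI impI)
  fix e :: real assume "e > 0"
  from assms(1)[unfolded abs_cont_on_def, rule_format, OF this]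
  obtain r where r: "r > 0" and ac: "\<forall>(N::nat) (u::nat \<Rightarrow> real) v.
        (\<forall>i<N. a \<le> u i \<and> u i \<le> v i \<and> v i \<le> b) \<and>
        (\<forall>i<N. \<forall>j<N. i \<noteq> j \<longrightarrow> v i \<le> u j \<or> v j \<le> u i) \<and>
        (\<Sum>i<N. v i - u i) < r
        \<longrightarrow> (\<Sum>i<N. norm (f (v i) - f (u i))) < e" by (elim exE conjE) (rule that)
  show "\<exists>r>0. \<forall>(N::nat) (u::nat \<Rightarrow> real) v.
        (\<forall>i<N. c \<le> u i \<and> u i \<le> v i \<and> v i \<le> d) \<and>
        (\<forall>i<N. \<forall>j<N. i \<noteq> j \<longrightarrow> v i \<le> u j \<or> v j \<le> u i) \<and>
        (\<Sum>i<N. v i - u i) < r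
        \<longrightarrow> (\<Sum>j<N. norm (f (v j) - f (u j))) < e"
  proof (intro exI[of _ r] conjI allI impI r)
    fix N and u v :: "nat \<Rightarrow> real"
    assume h: "(\<forall>i<N. c \<le> u i \<and> u i \<le> v i \<and> v i \<le> d) \<and>
        (\<forall>i<N. \<forall>j<N. i \<noteq> j \<longrightarrow> v i \<le> u j \<or> v j \<le> u i) \<and>
        (\<Sum>i<N. v i - u i) < r"
    have "\<forall>i<N. a \<le> u i \<and> u i \<le> v i \<and> v i \<le> b" using h assms(2,3) by force
    then show "(\<Sum>j<N. norm (f (v j) - f (u j))) < e"
      using ac[rule_format, of N u v] h by blast
  qed
qed

section \<open>The fundamental theorem of calculus\<close>

text \<open>The straddle lemma of gauge integration: the tag may sit anywhere in the interval, and
  the errors on its two sides add up to \<open>e * (v - u)\<close>. Inclusion in a ball is what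
  fineness of a tagged division provides.\<close>

lemma vector_derivative_straddle:
  fixes f :: "real \<Rightarrow> 'a::real_normed_vector"
  assumes "(f has_vector_derivative D) (at x)" "e > 0"
  obtains d where "d > 0" "\<And>u v. u \<le> x \<Longrightarrow> x \<le> v \<Longrightarrow> {u..v} \<subseteq> ball x d \<Longrightarrow> norm (f v - f u - (v - u) *\<^sub>R D) \<le> e * (v - u)"
proof -
  obtain d where d: "d > 0" "\<And>y. norm (y - x) < d \<Longrightarrow> norm (f y - f x - (y - x) *\<^sub>R D) \<le> e * norm (y - x)"
    using assms unfolding has_vector_derivative_def has_derivative_at_alt by blast
  show ?thesis
  proof (rule that[OF d(1)])
    fix u v assume uv: "u \<le> x" "x \<le> v" "{u..v} \<subseteq> ball x d"
    then have "norm (u - x) < d" "norm (v - x) < d"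
      using subsetD[OF uv(3), of u] subsetD[OF uv(3), of v] by (auto simp: dist_real_def)
    then have "norm (f v - f x - (v - x) *\<^sub>R D) \<le> e * (v - x)" "norm (f u - f x - (u - x) *\<^sub>R D) \<le> e * (x - u)"
      using d(2)[of u] d(2)[of v] uv by auto
    moreover have "f v - f u - (v - u) *\<^sub>R D = (f v - f x - (v - x) *\<^sub>R D) - (f u - f x - (u - x) *\<^sub>R D)"
      by (simp add: algebra_simps)
    ultimately show "norm (f v - f u - (v - u) *\<^sub>R D) \<le> e * (v - u)"
      using norm_triangle_ineq4[of "f v - f x - (v - x) *\<^sub>R D" "f u - f x - (u - x) *\<^sub>R D"] by (simp add: algebra_simps)
  qed
qed

text \<open>Two tags can carry the same interval only if it has empty interior, hence length 0,
  where \<open>h\<close> vanishes. Riemann sums thus become sums over sets of intervals, to which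
  absolute continuity and energy bounds apply.\<close>

lemma sum_over_tags:
  assumes p: "p tagged_division_of {a..b::real}" and P: "P \<subseteq> p"
    and h: "\<And>u v. content {u..v} = 0 \<Longrightarrow> h {u..v} = (0::real)"
  shows "(\<Sum>(x,k)\<in>P. h k) = sum h (snd ` P)"
proof -
  have "sum h (snd ` P) = sum (h \<circ> snd) P"
  proof (rule sum.reindex_nontrivial)
    show "finite P" using p P by (meson finite_subset tagged_division_of_finite)
    fix x y assume xy: "x \<in> P" "y \<in> P" "x \<noteq> y" "snd x = snd y"
    obtain t k s where x: "x = (t,k)" and y: "y = (s,k)" using xy(4) by (cases x, cases y) auto
    have "interior k \<inter> interior k = {}"
      using tagged_division_ofD(5)[OF p, of t k s k] xy x y P by blast
    moreover obtain u v where k: "k = {u..v}" using tagged_division_ofD(4)[OF p, of t k] x xy P by auto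
    ultimately have "content {u..v} = 0" by (simp add: content_real_if)
    then show "h (snd x) = 0" using h x k by simp
  qed
  then show ?thesis by (simp add: comp_def case_prod_unfold)
qed

text \<open>Tags outside the null set cost at most \<open>r\<close> times the length, by the
  straddle lemma. At tags in the null set the integrand is reset to 0, and the gauge forces the
  intervals into an open set of measure below \<open>d\<close>, where absolute continuity bounds the
  increments.\<close>

theorem abs_cont_on_has_integral:
  fixes f :: "real \<Rightarrow> 'a::euclidean_space"
  assumes f: "abs_cont_on a b f" and ab: "a \<le> b" and N: "negligible N"
    and der: "\<And>x. x \<in> {a<..<b} \<Longrightarrow> x \<notin> N \<Longrightarrow> (f has_vector_derivative g x) (at x)"
  shows "(g has_integral f b - f a) {a..b}"
proof -
  \<comment> \<open>The endpoints join the null set because the derivative is given only in the open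
    interval.\<close>
  define M where "M = insert a (insert b N)"
  define g' where "g' x = (if x \<in> M then 0 else g x)" for x
  have M: "negligible M" using N by (simp add: M_def)
  have "(g' has_integral f b - f a) {a..b}"
    unfolding has_integral_real
  proof (intro allI impI)
    fix e :: real assume e: "e > 0"
    then have e2: "e / 2 > 0" by simp
    obtain d where d: "d > 0" and ac:
      "\<And>D. nonoverlapping a b D \<Longrightarrow> sum content D < d \<Longrightarrow> (\<Sum>k\<in>D. norm (incr f k)) < e / 2"
      using abs_cont_on_division[OF f e2] by metis
    \<comment> \<open>The summand 1 keeps the quotient meaningful for \<open>a = b\<close> and makes
      \<open>r * (b - a)\<close> strictly less than \<open>e / 2\<close>.\<close>
    define r where "r = e / (2 * (b - a + 1))"
    have r: "r > 0" using e ab by (simp add: r_def)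
    have rb: "r * (b - a) < e / 2" using e ab by (simp add: r_def field_simps)
    have Ms: "M \<in> null_sets lebesgue" using M by (simp add: negligible_iff_null_sets)
    then have Ml: "M \<in> sets lebesgue" by auto
    obtain U where U: "open U" "M \<subseteq> U" "U - M \<in> lmeasurable" "emeasure lebesgue (U - M) < ennreal d"
      using sets_lebesgue_outer_open[OF Ml d] by blast
    have UM: "U = (U - M) \<union> M" using U by auto
    have "emeasure lebesgue U = emeasure lebesgue (U - M)"
      by (subst UM, rule emeasure_Un_null_set) (use U Ms in \<open>auto dest: fmeasurableD\<close>)
    then have eU: "emeasure lebesgue U < ennreal d" using U by simp
    then have Um: "U \<in> lmeasurable" using U(1)
      by (intro fmeasurableI) (auto simp: top.not_eq_extremum intro: order.strict_trans[OF _ ennreal_less_top])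
    have mU: "measure lebesgue U < d" using eU Um by (simp add: emeasure_eq_measure2 ennreal_less_iff)
    have "\<exists>s>0. \<forall>u v. u \<le> x \<longrightarrow> x \<le> v \<longrightarrow> {u..v} \<subseteq> ball x s \<longrightarrow> norm (f v - f u - (v - u) *\<^sub>R g x) \<le> r * (v - u)"
      if "x \<in> {a..b} - M" for x
    proof -
      have "(f has_vector_derivative g x) (at x)" using that by (intro der) (auto simp: M_def)
      then show ?thesis using vector_derivative_straddle[OF _ r] by metis
    qed
    then obtain s where s: "\<And>x. x \<in> {a..b} - M \<Longrightarrow> s x > 0"
      and sd: "\<And>x u v. x \<in> {a..b} - M \<Longrightarrow> u \<le> x \<Longrightarrow> x \<le> v \<Longrightarrow> {u..v} \<subseteq> ball x (s x) \<Longrightarrow> norm (f v - f u - (v - u) *\<^sub>R g x) \<le> r * (v - u)"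
      by metis
    define \<gamma> where "\<gamma> x = (if x \<in> M then U else if x \<in> {a..b} then ball x (s x) else ball x 1)" for x
    have gauge: "gauge \<gamma>" unfolding gauge_def \<gamma>_def using U s by auto
    show "\<exists>\<gamma>. gauge \<gamma> \<and> (\<forall>\<D>. \<D> tagged_division_of {a..b} \<and> \<gamma> fine \<D> \<longrightarrow>
        norm ((\<Sum>(x, k)\<in>\<D>. content k *\<^sub>R g' x) - (f b - f a)) < e)"
    proof (intro exI[of _ \<gamma>] conjI gauge allI impI)
      fix p assume "p tagged_division_of {a..b} \<and> \<gamma> fine p"
      then have p: "p tagged_division_of {a..b}" and fine: "\<gamma> fine p" by auto
      have fin: "finite p" using p by auto
      have incr: "incr f k = f (Sup k) - f (Inf k)" if "(x,k) \<in> p" for x k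
        using tagged_division_ofD(2)[OF p that] by (auto simp: incr_def)
      define P where "P = {(x,k)\<in>p. x \<in> M}"
      have Pp: "P \<subseteq> p" by (auto simp: P_def)
      have "(\<Sum>(x,k)\<in>p. incr f k) = f b - f a"
        unfolding additive_tagged_division_1[OF ab p, of f, symmetric]
        by (rule sum.cong) (auto simp: incr)
      then have "norm ((\<Sum>(x, k)\<in>p. content k *\<^sub>R g' x) - (f b - f a)) = norm (\<Sum>(x, k)\<in>p. content k *\<^sub>R g' x - incr f k)"
        by (simp add: sum_subtractf case_prod_unfold)
      also have "\<dots> \<le> (\<Sum>(x, k)\<in>p. norm (content k *\<^sub>R g' x - incr f k))"
        by (rule sum_norm_le) auto
      also have "\<dots> = (\<Sum>(x, k)\<in>p - P. norm (content k *\<^sub>R g' x - incr f k)) + (\<Sum>(x, k)\<in>P. norm (content k *\<^sub>R g' x - incr f k))"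
        by (rule sum.subset_diff[OF Pp fin])
      also have "(\<Sum>(x, k)\<in>P. norm (content k *\<^sub>R g' x - incr f k)) = (\<Sum>(x, k)\<in>P. norm (incr f k))"
        by (rule sum.cong) (auto simp: P_def g'_def)
      also have "\<dots> = (\<Sum>k\<in>snd ` P. norm (incr f k))"
        by (rule sum_over_tags[OF p Pp]) (simp add: incr_content_0)
      also have "\<dots> < e / 2"
      proof (rule ac)
        have div: "snd ` p division_of {a..b}" using division_of_tagged_division[OF p] .
        have sub: "snd ` P \<subseteq> snd ` p" using Pp by auto
        show "nonoverlapping a b (snd ` P)"
          unfolding nonoverlapping_def
        proof (intro conjI ballI impI)
          show "finite (snd ` P)" using fin Pp by (auto intro: finite_subset)
        next
          fix k assume "k \<in> snd ` P"
          then have k: "k \<in> snd ` p" using sub by blast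
          obtain u v where "k = {u..v}" using division_ofD(4)[OF div k] by auto
          moreover have "k \<noteq> {}" "k \<subseteq> {a..b}" using division_ofD(2,3)[OF div k] by auto
          ultimately have "k = {u..v} \<and> a \<le> u \<and> v \<le> b" by auto
          then show "\<exists>u v. k = {u..v} \<and> a \<le> u \<and> v \<le> b" by blast
        next
          fix k l assume kl: "k \<in> snd ` P" "l \<in> snd ` P" "k \<noteq> l"
          show "interior k \<inter> interior l = {}"
            by (rule division_ofD(5)[OF div subsetD[OF sub kl(1)] subsetD[OF sub kl(2)] kl(3)])
        qed
        have dP: "snd ` P division_of \<Union>(snd ` P)" by (rule division_of_subset[OF division_of_union_self[OF div] sub])
        have "sum content (snd ` P) = (\<Sum>k\<in>snd ` P. measure lebesgue k)"
        proof (rule sum.cong[OF refl])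
          fix k assume "k \<in> snd ` P"
          then obtain u v where "k = cbox u v" using division_ofD(4)[OF dP] by blast
          then show "content k = measure lebesgue k" by simp
        qed
        also have "\<dots> = measure lebesgue (\<Union>(snd ` P))" by (rule content_division[OF dP])
        also have "\<dots> \<le> measure lebesgue U"
        proof (rule measure_mono_fmeasurable[OF _ _ Um])
          show "\<Union>(snd ` P) \<subseteq> U" using fine by (fastforce simp: P_def fine_def \<gamma>_def)
          show "\<Union>(snd ` P) \<in> sets lebesgue" using lmeasurable_division[OF dP] by (rule fmeasurableD)
        qed
        also have "\<dots> < d" by (rule mU)
        finally show "sum content (snd ` P) < d" .
      qed
      also have "(\<Sum>(x, k)\<in>p - P. norm (content k *\<^sub>R g' x - incr f k)) \<le> (\<Sum>(x, k)\<in>p - P. r * content k)"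
      proof (rule sum_mono, clarify)
        fix x k assume xk: "(x, k) \<in> p" "(x, k) \<notin> P"
        have xM: "x \<in> {a..b} - M" using tag_in_interval[OF p xk(1)] xk by (auto simp: P_def)
        obtain u v where k: "k = {u..v}" using tagged_division_ofD(4)[OF p xk(1)] by auto
        have x: "u \<le> x" "x \<le> v" using tagged_division_ofD(2)[OF p xk(1)] k by auto
        have "k \<subseteq> \<gamma> x" using fine xk(1) by (auto simp: fine_def)
        then have "k \<subseteq> ball x (s x)" using xM by (simp add: \<gamma>_def)
        then have "norm (f v - f u - (v - u) *\<^sub>R g x) \<le> r * (v - u)" using sd[OF xM x] k by simp
        then show "norm (content k *\<^sub>R g' x - incr f k) \<le> r * content k"
          using xM x k by (simp add: g'_def incr_def norm_minus_commute)
      qed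
      also have "\<dots> \<le> (\<Sum>(x, k)\<in>p. r * content k)"
        by (rule sum_mono2[OF fin]) (use r in auto)
      also have "\<dots> = r * (\<Sum>(x, k)\<in>p. content k)" by (simp add: sum_distrib_left case_prod_unfold)
      also have "(\<Sum>(x, k)\<in>p. content k) = b - a"
        using additive_content_tagged_division[of p a b] p ab by simp
      finally show "norm ((\<Sum>(x, k)\<in>p. content k *\<^sub>R g' x) - (f b - f a)) < e"
        using rb by simp
    qed
  qed
  then show ?thesis
    by (rule has_integral_spike[OF M, rotated]) (auto simp: g'_def)
qed

section \<open>Energy of curves\<close>

lemma sum_integral_le:
  fixes h :: "real \<Rightarrow> real"
  assumes int: "h integrable_on {0..1}" and nn: "\<And>x. 0 \<le> h x"
    and uv: "\<forall>i<N. 0 \<le> u i \<and> u i \<le> v i \<and> v i \<le> 1"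
      "\<forall>i<N::nat. \<forall>j<N. i \<noteq> j \<longrightarrow> v i \<le> u j \<or> v j \<le> u i"
  shows "(\<Sum>i<N. integral {u i..v i} h) \<le> integral {0..1} h"
proof -
  \<comment> \<open>Open intervals, since closed ones may share an endpoint, where the sum could
    exceed \<open>h\<close>.\<close>
  let ?k = "\<lambda>i x. if x \<in> {u i<..<v i} then h x else 0"
  have "(?k i has_integral integral {u i..v i} h) {0..1}" if i: "i < N" for i
  proof -
    have "h integrable_on {u i..v i}"
      using uv(1) i by (intro integrable_on_subinterval[OF int]) auto
    then have "(h has_integral integral {u i..v i} h) {u i<..<v i}"
      using has_integral_open_interval[of h _ "u i" "v i"] by (simp add: has_integral_integral)
    moreover have "{u i<..<v i} \<subseteq> {0..1}" using uv(1) i by fastforce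
    ultimately show ?thesis using has_integral_restrict by blast
  qed
  then have "((\<lambda>x. \<Sum>i<N. ?k i x) has_integral (\<Sum>i<N. integral {u i..v i} h)) {0..1}"
    by (intro has_integral_sum) auto
  then show ?thesis
  proof (rule has_integral_le[OF _ integrable_integral[OF int]])
    fix x
    show "(\<Sum>i<N. ?k i x) \<le> h x"
    proof (cases "\<exists>j<N. x \<in> {u j<..<v j}")
      case True
      then obtain j where j: "j < N" "x \<in> {u j<..<v j}" by blast
      have "?k i x = 0" if "i < N" "i \<noteq> j" for i
        using uv(2) that j by fastforce
      then have "(\<Sum>i<N. ?k i x) = (\<Sum>i<N. if i = j then h x else 0)"
        using j by (intro sum.cong) auto
      also have "\<dots> = h x" using j by simp
      finally show ?thesis by simp
    next
      case False
      then have "(\<Sum>i<N. ?k i x) = 0" by (intro sum.neutral) auto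
      then show ?thesis using nn by simp
    qed
  qed
qed

text \<open>Isolates what the energy argument uses of the matrix cost; coercivity turns energy
  bounds into norm bounds.\<close>

locale energy_form =
  fixes B :: "'a::euclidean_space \<Rightarrow> 'a \<Rightarrow> real" and c :: real
  assumes bilinear: "bounded_bilinear B" and B_commute: "B x y = B y x"
    and c_pos: "c > 0" and coercive: "c * (norm x)\<^sup>2 \<le> B x x"
begin

lemmas B_simps = bounded_bilinear.add_left[OF bilinear] bounded_bilinear.add_right[OF bilinear]
  bounded_bilinear.diff_left[OF bilinear] bounded_bilinear.diff_right[OF bilinear]
  bounded_bilinear.scaleR_left[OF bilinear] bounded_bilinear.scaleR_right[OF bilinear]
  bounded_bilinear.zero_left[OF bilinear] bounded_bilinear.zero_right[OF bilinear]

lemma B_nonneg: "0 \<le> B x x"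
  using coercive[of x] c_pos by (meson mult_nonneg_nonneg order_trans less_imp_le zero_le_power2)

lemma continuous_on_B: "continuous_on S (\<lambda>x. B x x)"
  by (rule bounded_bilinear.continuous_on[OF bilinear continuous_on_id continuous_on_id])

text \<open>Degenerate intervals contribute \<open>0\<close> because \<open>x / 0 = 0\<close>.\<close>

definition energy_le :: "(real \<Rightarrow> 'a) \<Rightarrow> real \<Rightarrow> bool" where
  "energy_le f C \<longleftrightarrow> (\<forall>(N::nat) (u::nat \<Rightarrow> real) v.
     (\<forall>i<N. 0 \<le> u i \<and> u i \<le> v i \<and> v i \<le> 1) \<and>
     (\<forall>i<N. \<forall>j<N. i \<noteq> j \<longrightarrow> v i \<le> u j \<or> v j \<le> u i)
     \<longrightarrow> (\<Sum>i<N. B (f (v i) - f (u i)) (f (v i) - f (u i)) / (v i - u i)) \<le> C)"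

lemma energy_interval:
  assumes g: "(g has_integral f v - f u) {u..v}" and uv: "u \<le> v"
    and int: "(\<lambda>x. B (g x) (g x)) integrable_on {u..v}"
  shows "B (f v - f u) (f v - f u) / (v - u) \<le> integral {u..v} (\<lambda>x. B (g x) (g x))"
proof (cases "u = v")
  case False
  define D where "D = (f v - f u) /\<^sub>R (v - u)"
  have fD: "f v - f u = (v - u) *\<^sub>R D" using False by (simp add: D_def)
  \<comment> \<open>Jensen: integrate \<open>B g g \<ge> 2 B D g - B D D\<close>\<close>
  have "((\<lambda>x. B D (g x)) has_integral B D (f v - f u)) {u..v}"
    using has_integral_linear[OF g bounded_bilinear.bounded_linear_right[OF bilinear, of D]] by (simp add: comp_def)
  from has_integral_diff[OF has_integral_mult_right[OF this, of 2] has_integral_const_real[of "B D D" u v]]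
  have 1: "((\<lambda>x. 2 * B D (g x) - B D D) has_integral (v - u) * B D D) {u..v}"
    using uv by (simp add: fD B_simps mult.commute)
  have "(v - u) * B D D \<le> integral {u..v} (\<lambda>x. B (g x) (g x))"
  proof (rule has_integral_le[OF 1 integrable_integral[OF int]])
    fix x
    have "0 \<le> B (g x - D) (g x - D)" by (rule B_nonneg)
    then show "2 * B D (g x) - B D D \<le> B (g x) (g x)" using B_commute[of "g x" D] by (simp add: B_simps)
  qed
  moreover have "B (f v - f u) (f v - f u) / (v - u) = (v - u) * B D D"
    unfolding fD using False by (simp add: B_simps)
  ultimately show ?thesis by simp
qed simp

lemma energy_le_integral:
  assumes f: "abs_cont_on 0 1 f" and N: "negligible N"
    and der: "\<And>x. x \<in> {0<..<1} \<Longrightarrow> x \<notin> N \<Longrightarrow> (f has_vector_derivative g x) (at x)"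
    and int: "(\<lambda>x. B (g x) (g x)) integrable_on {0..1}"
  shows "energy_le f (integral {0..1} (\<lambda>x. B (g x) (g x)))"
  unfolding energy_le_def
proof (intro allI impI, elim conjE)
  fix n and u v :: "nat \<Rightarrow> real"
  assume uv: "\<forall>i<n. 0 \<le> u i \<and> u i \<le> v i \<and> v i \<le> 1"
      "\<forall>i<n. \<forall>j<n. i \<noteq> j \<longrightarrow> v i \<le> u j \<or> v j \<le> u i"
  have "(\<Sum>i<n. B (f (v i) - f (u i)) (f (v i) - f (u i)) / (v i - u i))
      \<le> (\<Sum>i<n. integral {u i..v i} (\<lambda>x. B (g x) (g x)))"
  proof (rule sum_mono)
    fix i assume "i \<in> {..<n}"
    then have i: "0 \<le> u i" "u i \<le> v i" "v i \<le> 1" using uv(1) by auto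
    have "(g has_integral f (v i) - f (u i)) {u i..v i}"
      by (rule abs_cont_on_has_integral[OF abs_cont_on_subset[OF f i(1,3)] i(2) N]) (use der i in auto)
    moreover have "(\<lambda>x. B (g x) (g x)) integrable_on {u i..v i}"
      using i by (intro integrable_on_subinterval[OF int]) auto
    ultimately show "B (f (v i) - f (u i)) (f (v i) - f (u i)) / (v i - u i) \<le> integral {u i..v i} (\<lambda>x. B (g x) (g x))"
      using energy_interval i(2) by blast
  qed
  also have "\<dots> \<le> integral {0..1} (\<lambda>x. B (g x) (g x))"
    by (rule sum_integral_le[OF int B_nonneg uv])
  finally show "(\<Sum>i<n. B (f (v i) - f (u i)) (f (v i) - f (u i)) / (v i - u i)) \<le> integral {0..1} (\<lambda>x. B (g x) (g x))" .
qed

lemma energy_le_nonneg: "energy_le f C \<Longrightarrow> 0 \<le> C"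
  unfolding energy_le_def by (drule spec[of _ 0]) simp

text \<open>The instance with a single interval: a Hoelder bound of exponent one half whose constant
  depends on \<open>C\<close> and \<open>c\<close> only, hence equicontinuity along a minimizing
  sequence.\<close>

lemma energy_le_modulus:
  assumes "energy_le f C" "0 \<le> u" "u \<le> v" "v \<le> 1"
  shows "c * (norm (f v - f u))\<^sup>2 \<le> C * (v - u)"
proof (cases "u = v")
  case False
  have "B (f v - f u) (f v - f u) / (v - u) \<le> C"
    using assms(1)[unfolded energy_le_def, rule_format, of 1 "\<lambda>_. u" "\<lambda>_. v"] assms by simp
  then have "B (f v - f u) (f v - f u) \<le> C * (v - u)" using False assms by (simp add: field_simps)
  then show ?thesis using coercive order_trans by blast
qed simp

text \<open>In place of Cauchy-Schwarz, the weighted inequality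
  \<open>2 * x \<le> \<eta> * x\<^sup>2 / l + l / \<eta>\<close> splits the sum of increments
  linearly into energy and total length.\<close>

lemma energy_le_abs_cont:
  assumes E: "energy_le f C"
  shows "abs_cont_on 0 1 f"
  unfolding abs_cont_on_def
proof (intro allI impI)
  fix e :: real assume e: "e > 0"
  have C: "0 \<le> C" using energy_le_nonneg[OF E] .
  \<comment> \<open>With this weight the energy part is at most \<open>e\<close>, and a total length
    below \<open>e * \<eta>\<close> makes the other part less than \<open>e\<close>;
    \<open>C + 1\<close> covers \<open>C = 0\<close>.\<close>
  define \<eta> where "\<eta> = e * c / (C + 1)"
  have \<eta>: "\<eta> > 0" using e c_pos C by (simp add: \<eta>_def)
  have \<eta>C: "\<eta> * (C / c) \<le> e"
    using e c_pos C by (simp add: \<eta>_def field_simps)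
  show "\<exists>d>0. \<forall>(N::nat) (u::nat \<Rightarrow> real) v.
        (\<forall>i<N. 0 \<le> u i \<and> u i \<le> v i \<and> v i \<le> 1) \<and>
        (\<forall>i<N. \<forall>j<N. i \<noteq> j \<longrightarrow> v i \<le> u j \<or> v j \<le> u i) \<and>
        (\<Sum>i<N. v i - u i) < d
        \<longrightarrow> (\<Sum>i<N. norm (f (v i) - f (u i))) < e"
  proof (intro exI[of _ "e * \<eta>"] conjI allI impI)
    show "0 < e * \<eta>" using e \<eta> by simp
    fix N and u v :: "nat \<Rightarrow> real"
    assume "(\<forall>i<N. 0 \<le> u i \<and> u i \<le> v i \<and> v i \<le> 1) \<and>
        (\<forall>i<N. \<forall>j<N. i \<noteq> j \<longrightarrow> v i \<le> u j \<or> v j \<le> u i) \<and> (\<Sum>i<N. v i - u i) < e * \<eta>"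
    then have uv: "\<forall>i<N. 0 \<le> u i \<and> u i \<le> v i \<and> v i \<le> 1"
      "\<forall>i<N. \<forall>j<N. i \<noteq> j \<longrightarrow> v i \<le> u j \<or> v j \<le> u i" and small: "(\<Sum>i<N. v i - u i) < e * \<eta>" by auto
    let ?E = "\<lambda>i. B (f (v i) - f (u i)) (f (v i) - f (u i)) / (v i - u i)"
    have "(\<Sum>i<N. norm (f (v i) - f (u i))) \<le> (\<Sum>i<N. (\<eta> / c * ?E i + (v i - u i) / \<eta>) / 2)"
    proof (rule sum_mono)
      fix i assume "i \<in> {..<N}"
      then have i: "u i \<le> v i" using uv by auto
      show "norm (f (v i) - f (u i)) \<le> (\<eta> / c * ?E i + (v i - u i) / \<eta>) / 2"
      proof (cases "u i = v i")
        case False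
        define l where "l = v i - u i"
        define x where "x = norm (f (v i) - f (u i))"
        have l: "l > 0" using i False by (simp add: l_def)
        have "c * x\<^sup>2 \<le> B (f (v i) - f (u i)) (f (v i) - f (u i))" unfolding x_def by (rule coercive)
        then have "c * x\<^sup>2 / l \<le> ?E i" using l unfolding l_def by (intro divide_right_mono) auto
        then have "\<eta> / c * (c * x\<^sup>2 / l) \<le> \<eta> / c * ?E i" using \<eta> c_pos by (intro mult_left_mono) auto
        then have "\<eta> * x\<^sup>2 / l \<le> \<eta> / c * ?E i" using c_pos by simp
        moreover have "2 * x \<le> \<eta> * x\<^sup>2 / l + l / \<eta>"
        proof -
          have "0 \<le> (\<eta> * x - l)\<^sup>2 / (\<eta> * l)" using \<eta> l by simp
          also have "\<dots> = \<eta> * x\<^sup>2 / l + l / \<eta> - 2 * x"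
            using \<eta> l by (simp add: field_simps power2_eq_square)
          finally show ?thesis by simp
        qed
        ultimately have "2 * x \<le> \<eta> / c * ?E i + l / \<eta>"
          by (meson add_right_mono order_trans)
        then show ?thesis unfolding x_def l_def by (simp add: mult.commute)
      qed simp
    qed
    also have "\<dots> = (\<eta> / c * (\<Sum>i<N. ?E i) + (\<Sum>i<N. v i - u i) / \<eta>) / 2"
      by (simp add: sum.distrib sum_distrib_left sum_divide_distrib add_divide_distrib)
    also have "\<dots> < (e + e) / 2"
    proof -
      have "(\<Sum>i<N. ?E i) \<le> C" using E uv unfolding energy_le_def by blast
      then have "\<eta> / c * (\<Sum>i<N. ?E i) \<le> \<eta> / c * C" using \<eta> c_pos by (intro mult_left_mono) auto
      moreover have "\<eta> / c * C \<le> e" using \<eta>C by simp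
      moreover have "(\<Sum>i<N. v i - u i) / \<eta> < e" using small \<eta> by (simp add: divide_less_eq)
      ultimately show ?thesis by (intro divide_strict_right_mono) linarith+
    qed
    finally show "(\<Sum>i<N. norm (f (v i) - f (u i))) < e" by simp
  qed
qed

text \<open>Lower semicontinuity: a discrete energy involves finitely many values of the curve, so
  it is continuous under pointwise convergence. The bounds may vary with \<open>n\<close>, so that
  they can descend to the infimum.\<close>

lemma energy_le_limit:
  assumes E: "\<And>n::nat. energy_le (f n) (C n)"
    and lim: "\<And>x. x \<in> {0..1} \<Longrightarrow> (\<lambda>n. f n x) \<longlonglongrightarrow> F x" and C: "C \<longlonglongrightarrow> L"
  shows "energy_le F L"
  unfolding energy_le_def
proof (intro allI impI, elim conjE)
  fix N and u v :: "nat \<Rightarrow> real"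
  assume uv: "\<forall>i<N. 0 \<le> u i \<and> u i \<le> v i \<and> v i \<le> 1"
      "\<forall>i<N. \<forall>j<N. i \<noteq> j \<longrightarrow> v i \<le> u j \<or> v j \<le> u i"
  have "(\<lambda>n. \<Sum>i<N. B (f n (v i) - f n (u i)) (f n (v i) - f n (u i)) / (v i - u i))
    \<longlonglongrightarrow> (\<Sum>i<N. B (F (v i) - F (u i)) (F (v i) - F (u i)) / (v i - u i))"
  proof (rule tendsto_sum)
    fix i assume "i \<in> {..<N}"
    then have "u i \<in> {0..1}" "v i \<in> {0..1}" using uv(1) by auto
    then have d: "(\<lambda>n. f n (v i) - f n (u i)) \<longlonglongrightarrow> F (v i) - F (u i)" by (intro tendsto_diff lim)
    show "(\<lambda>n. B (f n (v i) - f n (u i)) (f n (v i) - f n (u i)) / (v i - u i)) \<longlonglongrightarrow> B (F (v i) - F (u i)) (F (v i) - F (u i)) / (v i - u i)"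
      unfolding divide_inverse by (intro tendsto_mult_right bounded_bilinear.tendsto[OF bilinear] d)
  qed
  moreover have "(\<Sum>i<N. B (f n (v i) - f n (u i)) (f n (v i) - f n (u i)) / (v i - u i)) \<le> C n" for n
    using E[of n] uv unfolding energy_le_def by blast
  ultimately show "(\<Sum>i<N. B (F (v i) - F (u i)) (F (v i) - F (u i)) / (v i - u i)) \<le> L"
    using LIMSEQ_le[OF _ C] by blast
qed

lemma energy_le_division:
  assumes E: "energy_le f C" and D: "nonoverlapping 0 1 D"
  shows "(\<Sum>k\<in>D. B (incr f k) (incr f k) / content k) \<le> C"
proof -
  obtain N and u v :: "nat \<Rightarrow> real" where
    uv: "\<forall>i<N. 0 \<le> u i \<and> u i \<le> v i \<and> v i \<le> 1"
      "\<forall>i<N. \<forall>j<N. i \<noteq> j \<longrightarrow> v i \<le> u j \<or> v j \<le> u i"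
    and enum: "\<forall>h::real set \<Rightarrow> real. (\<forall>u v. content {u..v} = 0 \<longrightarrow> h {u..v} = 0) \<longrightarrow> sum h D = (\<Sum>i<N. h {u i..v i})"
    by (rule nonoverlapping_enumerate[OF D])
  have "(\<Sum>k\<in>D. B (incr f k) (incr f k) / content k)
      = (\<Sum>i<N. B (incr f {u i..v i}) (incr f {u i..v i}) / content {u i..v i})"
    by (rule enum[rule_format]) simp
  also have "\<dots> = (\<Sum>i<N. B (f (v i) - f (u i)) (f (v i) - f (u i)) / (v i - u i))"
    by (rule sum.cong) (use uv(1) in \<open>auto simp: incr_def\<close>)
  also have "\<dots> \<le> C" using E uv unfolding energy_le_def by blast
  finally show ?thesis .
qed

text \<open>Difference quotients over intervals straddling \<open>x\<close> are close to
  \<open>D\<close>, and the quadratic form is continuous at \<open>D\<close>; multiplying by the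
  length turns this into an estimate against one term of a discrete energy.\<close>

lemma derivative_energy_straddle:
  assumes "(f has_vector_derivative D) (at x)" "e > 0"
  obtains d where "d > 0" "\<And>u v. u \<le> x \<Longrightarrow> x \<le> v \<Longrightarrow> {u..v} \<subseteq> ball x d \<Longrightarrow>
    B D D * (v - u) \<le> B (f v - f u) (f v - f u) / (v - u) + e * (v - u)"
proof -
  have "isCont (\<lambda>z. B z z) D"
    using continuous_on_B[of UNIV] by (simp add: continuous_on_eq_continuous_at)
  then obtain r where r: "r > 0" "\<And>z. dist z D < r \<Longrightarrow> dist (B z z) (B D D) < e"
    using assms(2) unfolding continuous_at_eps_delta by blast
  \<comment> \<open>Half of \<open>r\<close>, because the straddle estimate is not strict while
    continuity asks for a distance less than \<open>r\<close>.\<close>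
  have "r / 2 > 0" using r by simp
  then obtain d where d: "d > 0" "\<And>u v. u \<le> x \<Longrightarrow> x \<le> v \<Longrightarrow> {u..v} \<subseteq> ball x d \<Longrightarrow> norm (f v - f u - (v - u) *\<^sub>R D) \<le> r / 2 * (v - u)"
    using vector_derivative_straddle[OF assms(1)] by metis
  show ?thesis
  proof (rule that[OF d(1)])
    fix u v assume uv: "u \<le> x" "x \<le> v" "{u..v} \<subseteq> ball x d"
    show "B D D * (v - u) \<le> B (f v - f u) (f v - f u) / (v - u) + e * (v - u)"
    proof (cases "u = v")
      case False
      then have l: "v - u > 0" using uv by simp
      define z where "z = (f v - f u) /\<^sub>R (v - u)"
      have fz: "f v - f u = (v - u) *\<^sub>R z" using l by (simp add: z_def)
      have "(v - u) * norm (z - D) \<le> r / 2 * (v - u)"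
        using d(2)[OF uv] l unfolding fz by (simp add: scaleR_diff_right[symmetric])
      then have "norm (z - D) \<le> r / 2" using l by (simp add: mult.commute)
      then have "dist (B z z) (B D D) < e" using r by (intro r(2)) (simp add: dist_norm)
      then have "B D D \<le> B z z + e" by (simp add: dist_real_def)
      then have "B D D * (v - u) \<le> (B z z + e) * (v - u)" using l by (intro mult_right_mono) auto
      moreover have "B (f v - f u) (f v - f u) / (v - u) = B z z * (v - u)"
        unfolding fz using l by (simp add: B_simps)
      ultimately show ?thesis by (simp add: algebra_simps)
    qed simp
  qed
qed

text \<open>A Riemann sum of \<open>h\<close> over a fine tagged division is at most a discrete
  energy plus \<open>e\<close>. A minorant appears because integrability of
  \<open>B (g x) (g x)\<close> is not yet known; truncations will take its place.\<close>

lemma integral_le_energy_of_minorant: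
  assumes E: "energy_le f C" and M: "{0, 1} \<subseteq> M"
    and der: "\<And>x. x \<in> {0..1} \<Longrightarrow> x \<notin> M \<Longrightarrow> (f has_vector_derivative g x) (at x)"
    and g0: "\<And>x. x \<in> M \<Longrightarrow> g x = 0"
    and h: "\<And>x. 0 \<le> h x" "\<And>x. h x \<le> B (g x) (g x)" and int: "(h has_integral I) {0..1}"
  shows "I \<le> C"
proof (rule field_le_epsilon)
  fix e' :: real assume e': "e' > 0"
  \<comment> \<open>One half pays for the straddle estimates over total length 1, the other for the
    distance of the Riemann sum from \<open>I\<close>.\<close>
  define e where "e = e' / 2"
  have e: "e > 0" using e' by (simp add: e_def)
  obtain \<gamma>1 where g1: "gauge \<gamma>1" and f1: "\<forall>p. p tagged_division_of {0..1} \<and> \<gamma>1 fine p \<longrightarrow>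
      norm ((\<Sum>(x,k)\<in>p. content k *\<^sub>R h x) - I) < e"
    using int[unfolded has_integral_real, rule_format, OF e] by (elim exE conjE) (rule that)
  have "\<exists>s>0. \<forall>u v. u \<le> x \<longrightarrow> x \<le> v \<longrightarrow> {u..v} \<subseteq> ball x s \<longrightarrow>
      B (g x) (g x) * (v - u) \<le> B (f v - f u) (f v - f u) / (v - u) + e * (v - u)"
    if "x \<in> {0..1} - M" for x
    using derivative_energy_straddle[OF der e, of x] that by (metis DiffD1 DiffD2)
  then obtain s where s: "\<And>x. x \<in> {0..1} - M \<Longrightarrow> s x > 0"
    and sd: "\<And>x u v. x \<in> {0..1} - M \<Longrightarrow> u \<le> x \<Longrightarrow> x \<le> v \<Longrightarrow> {u..v} \<subseteq> ball x (s x) \<Longrightarrow>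
      B (g x) (g x) * (v - u) \<le> B (f v - f u) (f v - f u) / (v - u) + e * (v - u)"
    by metis
  define \<gamma>2 where "\<gamma>2 x = ball x (if x \<in> {0..1} - M then s x else 1)" for x
  have g2: "gauge \<gamma>2" unfolding gauge_def \<gamma>2_def using s by auto
  obtain p where p: "p tagged_division_of {0..1}" and fine: "(\<lambda>x. \<gamma>1 x \<inter> \<gamma>2 x) fine p"
    using fine_division_exists_real[OF gauge_Int[OF g1 g2]] by blast
  have fine1: "\<gamma>1 fine p" and fine2: "\<gamma>2 fine p" using fine by (auto simp: fine_Int)
  have fin: "finite p" using p by auto
  have "(\<Sum>(x,k)\<in>p. content k *\<^sub>R h x) \<le> (\<Sum>(x,k)\<in>p. B (incr f k) (incr f k) / content k + e * content k)"
  proof (rule sum_mono, clarify)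
    fix x k assume xk: "(x,k) \<in> p"
    obtain u v where k: "k = {u..v}" using tagged_division_ofD(4)[OF p xk] by auto
    have x: "u \<le> x" "x \<le> v" using tagged_division_ofD(2)[OF p xk] k by auto
    have "h x * (v - u) \<le> B (f v - f u) (f v - f u) / (v - u) + e * (v - u)"
    proof (cases "x \<in> M")
      case True
      then have "h x = 0" using h(1)[of x] h(2)[of x] g0 B_simps by simp
      then show ?thesis using x e B_nonneg by simp
    next
      case False
      then have xM: "x \<in> {0..1} - M" using tag_in_interval[OF p xk] by auto
      have "k \<subseteq> \<gamma>2 x" using fine2 xk by (auto simp: fine_def)
      then have "{u..v} \<subseteq> ball x (s x)" using xM k by (simp add: \<gamma>2_def)
      then have "B (g x) (g x) * (v - u) \<le> B (f v - f u) (f v - f u) / (v - u) + e * (v - u)"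
        by (rule sd[OF xM x])
      moreover have "h x * (v - u) \<le> B (g x) (g x) * (v - u)" using h(2) x by (intro mult_right_mono) auto
      ultimately show ?thesis by linarith
    qed
    then show "content k *\<^sub>R h x \<le> B (incr f k) (incr f k) / content k + e * content k"
      using k x by (simp add: incr_def mult.commute)
  qed
  also have "\<dots> = (\<Sum>(x,k)\<in>p. B (incr f k) (incr f k) / content k) + e * (\<Sum>(x,k)\<in>p. content k)"
    by (simp add: sum.distrib sum_distrib_left case_prod_unfold)
  also have "(\<Sum>(x,k)\<in>p. content k) = 1"
    using additive_content_tagged_division[of p 0 1] p by simp
  also have "(\<Sum>(x,k)\<in>p. B (incr f k) (incr f k) / content k) = (\<Sum>k\<in>snd ` p. B (incr f k) (incr f k) / content k)"
    by (rule sum_over_tags[OF p order_refl]) simp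
  also have "\<dots> \<le> C"
  proof (rule energy_le_division[OF E])
    have div: "snd ` p division_of {0..1}" using division_of_tagged_division[OF p] .
    show "nonoverlapping 0 1 (snd ` p)"
      unfolding nonoverlapping_def
    proof (intro conjI ballI impI)
      show "finite (snd ` p)" using fin by simp
    next
      fix k assume k: "k \<in> snd ` p"
      obtain u v where "k = {u..v}" using division_ofD(4)[OF div k] by auto
      moreover have "k \<noteq> {}" "k \<subseteq> {0..1}" using division_ofD(2,3)[OF div k] by auto
      ultimately have "k = {u..v} \<and> 0 \<le> u \<and> v \<le> 1" by auto
      then show "\<exists>u v. k = {u..v} \<and> 0 \<le> u \<and> v \<le> 1" by blast
    next
      fix k l assume kl: "k \<in> snd ` p" "l \<in> snd ` p" "k \<noteq> l"
      show "interior k \<inter> interior l = {}" by (rule division_ofD(5)[OF div kl])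
    qed
  qed
  finally have "(\<Sum>(x,k)\<in>p. content k *\<^sub>R h x) \<le> C + e" by simp
  moreover have "\<bar>(\<Sum>(x,k)\<in>p. content k *\<^sub>R h x) - I\<bar> < e"
    using f1[rule_format, OF conjI[OF p fine1]] unfolding real_norm_def .
  moreover have "e' = 2 * e" by (simp add: e_def)
  ultimately show "I \<le> C + e'" by linarith
qed

text \<open>Converse of \<open>energy_le_integral\<close>. Truncated energy densities are bounded
  and measurable with integrals at most \<open>C\<close>; monotone convergence removes the
  truncation and yields integrability as well.\<close>

theorem integral_energy_le:
  assumes E: "energy_le f C" and N: "negligible N"
    and der: "\<And>x. x \<in> {0<..<1} \<Longrightarrow> x \<notin> N \<Longrightarrow> (f has_vector_derivative g x) (at x)"
  shows "(\<lambda>x. B (g x) (g x)) integrable_on {0..1}" "integral {0..1} (\<lambda>x. B (g x) (g x)) \<le> C"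
proof -
  have f: "abs_cont_on 0 1 f" by (rule energy_le_abs_cont[OF E])
  define M where "M = {0, 1} \<union> N"
  define g' where "g' x = (if x \<in> M then 0 else g x)" for x
  have M: "negligible M" using N by (simp add: M_def)
  have "(g has_integral f 1 - f 0) {0..1}" by (rule abs_cont_on_has_integral[OF f _ N der]) auto
  then have "(g' has_integral f 1 - f 0) {0..1}"
    by (rule has_integral_spike[OF M, rotated]) (auto simp: g'_def)
  \<comment> \<open>Measurability of the velocity comes from its gauge integrability.\<close>
  then have g'm: "g' \<in> borel_measurable (lebesgue_on {0..1})"
    using integrable_imp_measurable by blast
  define q where "q x = B (g' x) (g' x)" for x
  have "(\<lambda>x. B x x) \<in> borel_measurable borel"
    using continuous_on_B[of UNIV] by (rule borel_measurable_continuous_onI)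
  then have qm: "q \<in> borel_measurable (lebesgue_on {0..1})"
    unfolding q_def using g'm by (rule measurable_compose[rotated])
  define h where "h n x = min (q x) (real n)" for n x
  have hint: "h n integrable_on {0..1}" for n
  proof (rule measurable_bounded_by_integrable_imp_integrable)
    show "h n \<in> borel_measurable (lebesgue_on {0..1})" unfolding h_def using qm by measurable
    show "(\<lambda>x. real n) integrable_on {0..1::real}" by (rule integrable_const_ivl)
    show "norm (h n x) \<le> real n" for x using B_nonneg[of "g' x"] by (auto simp: h_def q_def)
  qed auto
  have hle: "integral {0..1} (h n) \<le> C" for n
  proof (rule integral_le_energy_of_minorant[OF E, of M g' "h n"])
    show "(f has_vector_derivative g' x) (at x)" if "x \<in> {0..1}" "x \<notin> M" for x
      using der[of x] that by (auto simp: g'_def M_def)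
  qed (use B_nonneg in \<open>auto simp: M_def g'_def h_def q_def hint intro: integrable_integral\<close>)
  have mc: "q integrable_on {0..1} \<and> (\<lambda>n. integral {0..1} (h n)) \<longlonglongrightarrow> integral {0..1} q"
  proof (rule monotone_convergence_increasing[OF hint])
    show "h n x \<le> h (Suc n) x" for n x by (auto simp: h_def)
    show "(\<lambda>n. h n x) \<longlonglongrightarrow> q x" for x
    proof (rule tendsto_eventually)
      obtain m :: nat where "q x \<le> real m" using real_arch_simple by blast
      then show "\<forall>\<^sub>F n in sequentially. h n x = q x"
        unfolding eventually_sequentially h_def by (intro exI[of _ m]) auto
    qed
    have "0 \<le> integral {0..1} (h n)" for n
      by (rule integral_nonneg[OF hint]) (auto simp: h_def q_def B_nonneg)
    then show "bounded (range (\<lambda>n. integral {0..1} (h n)))"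
      using hle by (intro boundedI[of _ C]) auto
  qed
  then have "integral {0..1} q \<le> C" using hle LIMSEQ_le_const2 by blast
  moreover have "((\<lambda>x. B (g x) (g x)) has_integral integral {0..1} q) {0..1}"
    by (rule has_integral_spike[OF M _ integrable_integral[OF conjunct1[OF mc]]]) (auto simp: q_def g'_def)
  ultimately show "(\<lambda>x. B (g x) (g x)) integrable_on {0..1}" "integral {0..1} (\<lambda>x. B (g x) (g x)) \<le> C"
    by (auto simp: integral_unique)
qed

end

section \<open>Matrix curves\<close>

text \<open>This is \<open>trace (A ** S ** transpose C)\<close> expanded over rows, so that
  coercivity reduces to that of \<open>S\<close> on vectors.\<close>

definition row_form :: "real^'n^'n \<Rightarrow> real^'n^'m \<Rightarrow> real^'n^'m \<Rightarrow> real" where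
  "row_form S A C = (\<Sum>i\<in>UNIV. (A $ i) \<bullet> (S *v (C $ i)))"

lemma row_form_trace:
  fixes S :: "real^'n^'n" and A :: "real^'n^'m"
  assumes "transpose S = S"
  shows "trace (A ** S ** transpose A) = row_form S A A"
proof -
  have "(A ** S ** transpose A) $ i $ i = (A $ i) \<bullet> (S *v (A $ i))" for i
  proof -
    have "(A ** S ** transpose A) $ i $ i = (\<Sum>k\<in>UNIV. (\<Sum>j\<in>UNIV. A $ i $ j * S $ j $ k) * A $ i $ k)"
      by (simp add: matrix_matrix_mult_def transpose_def)
    also have "\<dots> = (\<Sum>j\<in>UNIV. \<Sum>k\<in>UNIV. A $ i $ j * S $ j $ k * A $ i $ k)"
      by (subst sum.swap) (simp add: sum_distrib_right)
    also have "\<dots> = (A $ i) \<bullet> (S *v (A $ i))"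
      by (simp add: inner_vec_def matrix_vector_mult_def sum_distrib_left mult.assoc)
    finally show ?thesis .
  qed
  then show ?thesis by (simp add: trace_def row_form_def)
qed

text \<open>\<open>c\<close> is the minimum of the quadratic form on the compact unit sphere,
  positive there; homogeneity extends the bound to all vectors.\<close>

lemma SymPos_coercive:
  assumes "S \<in> SymPos"
  obtains c where "c > 0" "\<And>x. c * (norm x)\<^sup>2 \<le> x \<bullet> (S *v x)"
proof -
  let ?q = "\<lambda>x. x \<bullet> (S *v x)"
  have "continuous_on (sphere 0 1) ?q"
    by (intro continuous_intros matrix_vector_mult_linear_continuous_on)
  moreover have "axis (undefined::'a) (1::real) \<in> sphere 0 1" by simp
  ultimately obtain x0 where x0: "x0 \<in> sphere 0 1" "\<And>y. y \<in> sphere 0 1 \<Longrightarrow> ?q x0 \<le> ?q y"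
    using continuous_attains_inf[OF compact_sphere, of "0" 1 ?q] by blast
  show ?thesis
  proof (rule that)
    have "x0 \<noteq> 0" using x0(1) by auto
    then show "?q x0 > 0" using assms by (simp add: SymPos_def)
    fix x :: "real^'a"
    show "?q x0 * (norm x)\<^sup>2 \<le> ?q x"
    proof (cases "x = 0")
      case False
      define y where "y = x /\<^sub>R norm x"
      have xy: "x = norm x *\<^sub>R y" using False by (simp add: y_def)
      have "y \<in> sphere 0 1" using False by (simp add: y_def)
      then have "?q x0 * (norm x)\<^sup>2 \<le> ?q y * (norm x)\<^sup>2" using x0(2) by (intro mult_right_mono) auto
      also have "\<dots> = ?q (norm x *\<^sub>R y)"
        by (simp add: matrix_vector_mult_scaleR power2_eq_square)
      also have "\<dots> = ?q x" by (simp only: xy[symmetric])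
      finally show ?thesis .
    qed simp
  qed
qed

lemma row_form_energy_form:
  fixes S :: "real^'n^'n"
  assumes S: "S \<in> SymPos"
  obtains c where "energy_form (row_form S :: real^'n^'m \<Rightarrow> _) c"
proof -
  have sym: "transpose S = S" using S by (simp add: SymPos_def)
  obtain c where c: "c > 0" "\<And>x. c * (norm x)\<^sup>2 \<le> x \<bullet> (S *v x)"
    using SymPos_coercive[OF S] by metis
  have "energy_form (row_form S :: real^'n^'m \<Rightarrow> _) c"
  proof (rule energy_form.intro)
    have "bilinear (row_form S :: real^'n^'m \<Rightarrow> _)"
      unfolding bilinear_def row_form_def
      by (auto intro!: linearI simp: inner_add_left inner_add_right sum.distrib matrix_vector_right_distrib
          matrix_vector_mult_scaleR sum_distrib_left)
    then show "bounded_bilinear (row_form S :: real^'n^'m \<Rightarrow> _)" by (simp add: bilinear_conv_bounded_bilinear)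
    fix x y :: "real^'n^'m"
    have "(x $ i) \<bullet> (S *v (y $ i)) = (y $ i) \<bullet> (S *v (x $ i))" for i
      by (metis dot_lmul_matrix inner_commute sym transpose_matrix_vector)
    then show "row_form S x y = row_form S y x" by (simp add: row_form_def)
    have "(norm x)\<^sup>2 = (\<Sum>i\<in>UNIV. (norm (x $ i))\<^sup>2)"
      by (simp add: norm_vec_def L2_set_def sum_nonneg)
    then show "c * (norm x)\<^sup>2 \<le> row_form S x x"
      unfolding row_form_def using c(2) by (simp add: sum_distrib_left sum_mono)
  qed (rule c(1))
  then show ?thesis by (rule that)
qed

lemma continuous_on_det:
  fixes A :: "'a::topological_space \<Rightarrow> real^'n^'n"
  assumes "continuous_on T A"
  shows "continuous_on T (\<lambda>t. det (A t))"
  unfolding det_def by (intro continuous_intros assms)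

text \<open>Cramer's rule writes the entries of the inverse as quotients of determinants, which
  depend continuously on the entries of \<open>A t\<close>.\<close>

lemma continuous_inverse_exists:
  fixes A :: "'a::topological_space \<Rightarrow> real^'n^'n"
  assumes A: "continuous_on T A" and inv: "\<And>t. t \<in> T \<Longrightarrow> invertible (A t)"
  obtains W where "continuous_on T W" "\<And>t. t \<in> T \<Longrightarrow> W t ** A t = mat 1"
proof -
  \<comment> \<open>Column \<open>l\<close> is Cramer's solution of
    \<open>A t *v x = axis l 1\<close>.\<close>
  define W where "W t = (\<chi> k l. det (\<chi> i j. if j = k then (axis l 1 :: real^'n) $ i else A t $ i $ j) / det (A t))" for t
  have nz: "det (A t) \<noteq> 0" if "t \<in> T" for t using inv[OF that] by (simp add: invertible_det_nz)
  have "continuous_on T (\<lambda>t. (if j = k then (axis l 1 :: real^'n) $ i else A t $ i $ j))" for i j k l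
    using A by (cases "j = k") (auto intro: continuous_intros)
  then have c: "continuous_on T W"
    unfolding W_def using nz by (intro continuous_intros continuous_on_det A ballI) auto
  have "A t ** W t = mat 1" if t: "t \<in> T" for t
  proof -
    have "A t *v column l (W t) = axis l 1" for l
    proof -
      have "column l (W t) = (\<chi> k. det (\<chi> i j. if j = k then (axis l 1 :: real^'n) $ i else A t $ i $ j) / det (A t))"
        by (simp add: column_def W_def vec_eq_iff)
      then show ?thesis by (rule iffD2[OF cramer[OF nz[OF t]]])
    qed
    moreover have "(A t ** W t) $ i $ l = (A t *v column l (W t)) $ i" for i l
      by (simp add: matrix_matrix_mult_def matrix_vector_mult_def column_def)
    ultimately have "(A t ** W t) $ i $ l = (axis l 1 :: real^'n) $ i" for i l by simp
    then show ?thesis by (simp add: vec_eq_iff mat_def axis_def)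
  qed
  then have "W t ** A t = mat 1" if "t \<in> T" for t using that matrix_left_right_inverse by blast
  then show ?thesis by (rule that[OF c])
qed

lemma bilinear_matrix_matrix_mult:
  "bilinear (matrix_matrix_mult :: real^'n^'m \<Rightarrow> real^'k^'n \<Rightarrow> real^'k^'m)"
  unfolding bilinear_def
  by (auto intro!: linearI simp: vec_eq_iff matrix_matrix_mult_def
      sum.distrib sum_distrib_left algebra_simps)

lemma tendsto_matrix_matrix_mult:
  fixes f :: "'a \<Rightarrow> real^'n^'m" and g :: "'a \<Rightarrow> real^'k^'n"
  assumes "(f \<longlongrightarrow> A) F" "(g \<longlongrightarrow> C) F"
  shows "((\<lambda>x. f x ** g x) \<longlongrightarrow> A ** C) F"
  using bounded_bilinear.tendsto[OF bilinear_matrix_matrix_mult[unfolded bilinear_conv_bounded_bilinear] assms] .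

lemma tendsto_transpose:
  fixes f :: "'a \<Rightarrow> real^'n^'m"
  assumes "(f \<longlongrightarrow> A) F"
  shows "((\<lambda>x. transpose (f x)) \<longlongrightarrow> transpose A) F"
  unfolding transpose_def by (intro tendsto_vec_lambda tendsto_vec_nth assms)

section \<open>The kinetic energy as the energy of the curve alone\<close>

lemma KE_integrand_row_form:
  assumes "transpose S = S"
  shows "KE_integrand S K Phi t = row_form S (K t ** Phi t) (K t ** Phi t)"
  using row_form_trace[OF assms, of "K t ** Phi t"]
  by (simp add: KE_integrand_def matrix_transpose_mul matrix_mul_assoc)

lemma J_KE_row_form:
  assumes "transpose S = S" and "integrable (lebesgue_on {0..1}) (KE_integrand S K Phi)"
  shows "(\<lambda>t. row_form S (K t ** Phi t) (K t ** Phi t)) integrable_on {0..1}"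
    "2 * J_KE S K Phi = integral {0..1} (\<lambda>t. row_form S (K t ** Phi t) (K t ** Phi t))"
proof -
  have eq: "KE_integrand S K Phi = (\<lambda>t. row_form S (K t ** Phi t) (K t ** Phi t))"
    by (rule ext) (rule KE_integrand_row_form[OF assms(1)])
  show "(\<lambda>t. row_form S (K t ** Phi t) (K t ** Phi t)) integrable_on {0..1}"
    using integrable_on_lebesgue_on[OF assms(2)] eq by simp
  show "2 * J_KE S K Phi = integral {0..1} (\<lambda>t. row_form S (K t ** Phi t) (K t ** Phi t))"
    using lebesgue_integral_eq_integral[OF assms(2)] eq by (simp add: J_KE_def)
qed

text \<open>The differential equation binds \<open>K\<close> only where \<open>Phi\<close> is
  differentiable; these are almost all points, so \<open>K t ** Phi t\<close> is the velocity off a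
  null set.\<close>

lemma admissible_energy_le:
  fixes Sig :: "real \<Rightarrow> real^'n^'n" and Y0 :: "real^'m^'n"
  assumes ef: "energy_form (row_form (Sig 0) :: real^'n^'n \<Rightarrow> _) c" and sym: "transpose (Sig 0) = Sig 0"
    and adm: "admissible Sig Y0 Y1 K Phi"
  shows "energy_form.energy_le (row_form (Sig 0)) Phi (2 * J_KE (Sig 0) K Phi)"
proof -
  interpret energy_form "row_form (Sig 0) :: real^'n^'n \<Rightarrow> _" c by (rule ef)
  have AC: "abs_cont_on 0 1 Phi" and KE: "integrable (lebesgue_on {0..1}) (KE_integrand (Sig 0) K Phi)"
    and D: "\<And>t D. t \<in> {0<..<1} \<Longrightarrow> (Phi has_vector_derivative D) (at t) \<Longrightarrow> D = K t ** Phi t"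
    using adm unfolding admissible_def by blast+
  show ?thesis
    unfolding J_KE_row_form(2)[OF sym KE]
  proof (rule energy_le_integral[OF AC abs_cont_on_differentiable_ae[OF AC] _ J_KE_row_form(1)[OF sym KE]])
    fix x :: real assume x: "x \<in> {0<..<1}" "x \<notin> {x \<in> {0<..<1}. \<not> Phi differentiable (at x)}"
    then have "(Phi has_vector_derivative vector_derivative Phi (at x)) (at x)"
      by (simp add: vector_derivative_works)
    then show "(Phi has_vector_derivative K x ** Phi x) (at x)" using D[OF x(1)] by simp
  qed
qed

text \<open>\<open>K\<close> is rebuilt as velocity times inverse. The inverse is continuous, hence
  bounded on the compact interval, so square integrability of \<open>K\<close> follows from
  coercivity and the finite energy of the velocity.\<close>

lemma energy_le_admissible:
  fixes Sig :: "real \<Rightarrow> real^'n^'n" and Y0 :: "real^'m^'n"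
  assumes ef: "energy_form (row_form (Sig 0) :: real^'n^'n \<Rightarrow> _) c" and sym: "transpose (Sig 0) = Sig 0"
    and E: "energy_form.energy_le (row_form (Sig 0)) Phi C"
    and inv: "\<forall>t\<in>{0..1}. invertible (Phi t)" and Phi0: "Phi 0 = mat 1"
    and Sig: "\<forall>t\<in>{0..1}. Sig t = Phi t ** Sig 0 ** transpose (Phi t)" and Y: "Y1 = Phi 1 ** Y0"
  obtains K where "admissible Sig Y0 Y1 K Phi" "2 * J_KE (Sig 0) K Phi \<le> C"
proof -
  interpret energy_form "row_form (Sig 0) :: real^'n^'n \<Rightarrow> _" c by (rule ef)
  have AC: "abs_cont_on 0 1 Phi" by (rule energy_le_abs_cont[OF E])
  have cont: "continuous_on {0..1} Phi" by (rule abs_cont_on_imp_continuous_on[OF AC])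
  obtain W where W: "continuous_on {0..1} W" "\<And>t. t \<in> {0..1} \<Longrightarrow> W t ** Phi t = mat 1"
    using continuous_inverse_exists[OF cont] inv by metis
  \<comment> \<open>Within \<open>{0<..<1}\<close> the default 0 occurs only on a null set, where
    the differential equation in \<open>admissible\<close> is silent.\<close>
  define g where "g t = (if Phi differentiable (at t) then vector_derivative Phi (at t) else 0)" for t
  define K where "K t = g t ** W t" for t
  let ?N = "{x \<in> {0<..<1}. \<not> Phi differentiable (at x)}"
  have N: "negligible ?N" by (rule abs_cont_on_differentiable_ae[OF AC])
  have der: "(Phi has_vector_derivative g x) (at x)" if "x \<in> {0<..<1}" "x \<notin> ?N" for x
    using that by (simp add: g_def vector_derivative_works)
  have KPhi: "K t ** Phi t = g t" if "t \<in> {0..1}" for t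
    using W(2)[OF that] by (simp add: K_def matrix_mul_assoc[symmetric])
  have Eint: "(\<lambda>x. row_form (Sig 0) (g x) (g x)) integrable_on {0..1}"
    and Ele: "integral {0..1} (\<lambda>x. row_form (Sig 0) (g x) (g x)) \<le> C"
    using integral_energy_le[OF E N der] by auto
  have Eleb: "integrable (lebesgue_on {0..1}) (\<lambda>x. row_form (Sig 0) (g x) (g x))"
    using nonnegative_absolutely_integrable_1[OF Eint] B_nonneg
    by (simp add: integrable_restrict_space set_integrable_def)
  have KE: "integrable (lebesgue_on {0..1}) (KE_integrand (Sig 0) K Phi)"
    using Eleb
    by (subst Bochner_Integration.integrable_cong[OF refl, of _ _ "\<lambda>x. row_form (Sig 0) (g x) (g x)"])
      (auto simp: KE_integrand_row_form[OF sym] KPhi)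
  have gm: "g \<in> borel_measurable (lebesgue_on {0..1})"
    using abs_cont_on_has_integral[OF AC _ N der] integrable_imp_measurable by auto
  have Wm: "W \<in> borel_measurable (lebesgue_on {0..1})"
    by (rule continuous_imp_measurable_on_sets_lebesgue[OF W(1)]) simp
  have Km: "K \<in> borel_measurable (lebesgue_on {0..1})"
    unfolding K_def by (rule borel_measurable_bilinear[OF bilinear_matrix_matrix_mult gm Wm]) simp
  obtain R where R: "R > 0" "\<And>(A::real^'n^'n) (C::real^'n^'n). norm (A ** C) \<le> norm A * norm C * R"
    using bounded_bilinear.pos_bounded[OF bilinear_matrix_matrix_mult[unfolded bilinear_conv_bounded_bilinear]] by blast
  have "bounded (W ` {0..1})"
    by (rule compact_imp_bounded[OF compact_continuous_image[OF W(1)]]) simp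
  then obtain w where w: "\<And>t. t \<in> {0..1} \<Longrightarrow> norm (W t) \<le> w" unfolding bounded_iff by blast
  have K2: "integrable (lebesgue_on {0..1}) (\<lambda>t. (norm (K t))\<^sup>2)"
  proof (rule measurable_bounded_by_integrable_imp_lebesgue_integrable)
    show "(\<lambda>t. (norm (K t))\<^sup>2) \<in> borel_measurable (lebesgue_on {0..1})" using Km by measurable
    \<comment> \<open>\<open>w\<close> bounds the inverse, \<open>R\<close> is the constant of
      matrix multiplication, and \<open>1 / c\<close> comes from coercivity.\<close>
    show "integrable (lebesgue_on {0..1}) (\<lambda>t. (w * R)\<^sup>2 / c * row_form (Sig 0) (g t) (g t))"
      using Eleb by simp
    fix t :: real assume t: "t \<in> {0..1}"
    have "norm (K t) \<le> norm (g t) * norm (W t) * R" unfolding K_def by (rule R(2))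
    also have "\<dots> \<le> norm (g t) * w * R"
      using w[OF t] R(1) by (intro mult_right_mono mult_left_mono) auto
    finally have "(norm (K t))\<^sup>2 \<le> (norm (g t) * w * R)\<^sup>2" by (intro power_mono) auto
    also have "\<dots> = (w * R)\<^sup>2 / c * (c * (norm (g t))\<^sup>2)"
      using c_pos by (simp add: power_mult_distrib)
    also have "\<dots> \<le> (w * R)\<^sup>2 / c * row_form (Sig 0) (g t) (g t)"
      using coercive c_pos by (intro mult_left_mono) auto
    finally show "norm ((norm (K t))\<^sup>2) \<le> (w * R)\<^sup>2 / c * row_form (Sig 0) (g t) (g t)" by simp
  qed simp
  have "D = K t ** Phi t" if t: "t \<in> {0<..<1}" and D: "(Phi has_vector_derivative D) (at t)" for t D
  proof -
    have "Phi differentiable (at t)" using D by (auto simp: has_vector_derivative_def differentiable_def)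
    then have "g t = D" using vector_derivative_at[OF D] by (simp add: g_def)
    then show ?thesis using KPhi t by simp
  qed
  then have "admissible Sig Y0 Y1 K Phi"
    unfolding admissible_def using Km K2 AC inv Phi0 Sig Y KE by blast
  moreover have "2 * J_KE (Sig 0) K Phi \<le> C"
  proof -
    have "integral {0..1} (\<lambda>t. row_form (Sig 0) (K t ** Phi t) (K t ** Phi t)) = integral {0..1} (\<lambda>x. row_form (Sig 0) (g x) (g x))"
      by (rule integral_cong) (simp add: KPhi)
    then show ?thesis using J_KE_row_form(2)[OF sym KE] Ele by simp
  qed
  ultimately show ?thesis by (rule that)
qed

section \<open>Existence of a minimizer by compactness\<close>

lemma SymPos_invertible:
  assumes "S \<in> SymPos"
  shows "invertible S"
proof -
  have "x = 0" if "S *v x = 0" for x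
    using assms that unfolding SymPos_def by force
  then show ?thesis
    by (simp add: invertible_left_inverse matrix_left_invertible_ker)
qed

lemma equicontinuous_of_sqrt_modulus:
  fixes f :: "'i \<Rightarrow> real \<Rightarrow> 'a::real_normed_vector"
  assumes c: "c > 0" and C: "C \<ge> 0" and e: "e > 0"
    and mod: "\<And>n u v. 0 \<le> u \<Longrightarrow> u \<le> v \<Longrightarrow> v \<le> 1 \<Longrightarrow> c * (norm (f n v - f n u))\<^sup>2 \<le> C * (v - u)"
  obtains d where "d > 0"
    "\<And>n x y. x \<in> {0..1} \<Longrightarrow> y \<in> {0..1} \<Longrightarrow> norm (x - y) < d \<Longrightarrow> norm (f n x - f n y) < e"
proof -
  \<comment> \<open>Solves \<open>(C + 1) * d = c * e\<^sup>2\<close>; the summand 1 gives a strict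
    estimate also for \<open>C = 0\<close>.\<close>
  define d where "d = c * e\<^sup>2 / (C + 1)"
  have d: "d > 0" using c C e by (simp add: d_def)
  have key: "norm (f n v - f n u) < e" if "0 \<le> u" "u \<le> v" "v \<le> 1" "v - u < d" for n u v
  proof -
    have "c * (norm (f n v - f n u))\<^sup>2 \<le> C * (v - u)" using mod that by blast
    also have "\<dots> \<le> (C + 1) * (v - u)" using that by (intro mult_right_mono) auto
    also have "\<dots> < (C + 1) * d" using that C by (intro mult_strict_left_mono) auto
    also have "\<dots> = c * e\<^sup>2" using C by (simp add: d_def)
    finally have "(norm (f n v - f n u))\<^sup>2 < e\<^sup>2" using c by simp
    then show ?thesis using e by (meson less_imp_le power_less_imp_less_base)
  qed
  show ?thesis
  proof (rule that[OF d])
    fix n and x y :: real assume "x \<in> {0..1}" "y \<in> {0..1}" "norm (x - y) < d"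
    then show "norm (f n x - f n y) < e"
      using key[of x y n] key[of y x n] by (cases "x \<le> y") (auto simp: norm_minus_commute)
  qed
qed

theorem theorem1:
  fixes Sig :: "real \<Rightarrow> real^'n^'n"
    and Y0 Y1 :: "real^'m^'n"
  assumes "CARD('n) \<ge> 2"
    and "CARD('m) < CARD('n)"
    and "\<forall>t\<in>{0..1}. Sig t \<in> SymPos"
    and "C1_curve Sig"
    and "\<exists>K Phi. admissible Sig Y0 Y1 K Phi"
  shows "\<exists>Ks Phis. admissible Sig Y0 Y1 Ks Phis \<and>
           (\<forall>K Phi. admissible Sig Y0 Y1 K Phi \<longrightarrow>
              J_KE (Sig 0) Ks Phis \<le> J_KE (Sig 0) K Phi)"
proof -
  have S0: "Sig 0 \<in> SymPos" using assms(3) by auto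
  have trS: "transpose (Sig 0) = Sig 0" using S0 by (simp add: SymPos_def)
  obtain c where ef: "energy_form (row_form (Sig 0) :: real^'n^'n \<Rightarrow> _) c"
    using row_form_energy_form[OF S0] by blast
  interpret energy_form "row_form (Sig 0) :: real^'n^'n \<Rightarrow> _" c by (rule ef)
  define X where "X = {J_KE (Sig 0) K Phi | K Phi. admissible Sig Y0 Y1 K Phi}"
  define m where "m = Inf X"
  have X: "X \<noteq> {}" using assms(5) by (auto simp: X_def)
  \<comment> \<open>Nonnegativity of the cost, read off from the empty system of intervals, bounds
    the infimum from below.\<close>
  have "0 \<le> x" if "x \<in> X" for x
    using that energy_le_nonneg[OF admissible_energy_le[where Sig = Sig, OF ef trS]] by (fastforce simp: X_def)
  then have bdd: "bdd_below X" by (rule bdd_belowI)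
  have "\<exists>K Phi. admissible Sig Y0 Y1 K Phi \<and> J_KE (Sig 0) K Phi < m + 1 / real (Suc n)" for n
    using cInf_lessD[OF X, of "m + 1 / real (Suc n)"] by (force simp: X_def m_def)
  then obtain K Phi where adm: "\<And>n. admissible Sig Y0 Y1 (K n) (Phi n)"
    and J: "\<And>n. J_KE (Sig 0) (K n) (Phi n) < m + 1 / real (Suc n)" by metis
  let ?C = "\<lambda>n. 2 * J_KE (Sig 0) (K n) (Phi n)"
  have E: "energy_le (Phi n) (?C n)" for n by (rule admissible_energy_le[where Sig = Sig, OF ef trS adm])
  have mJ: "m \<le> J_KE (Sig 0) K Phi" if "admissible Sig Y0 Y1 K Phi" for K Phi
    unfolding m_def using that by (intro cInf_lower[OF _ bdd]) (auto simp: X_def)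
  have Clim: "?C \<longlonglongrightarrow> 2 * m"
  proof (rule tendsto_sandwich)
    show "\<forall>\<^sub>F n in sequentially. 2 * m \<le> ?C n" using mJ[OF adm] by auto
    show "\<forall>\<^sub>F n in sequentially. ?C n \<le> 2 * (m + 1 / real (Suc n))"
      by (intro always_eventually allI mult_left_mono less_imp_le[OF J]) simp
    have "(\<lambda>n. 2 * (m + 1 / real (Suc n))) \<longlonglongrightarrow> 2 * (m + 0)"
      by (intro tendsto_intros LIMSEQ_Suc lim_1_over_n)
    then show "(\<lambda>n. 2 * (m + 1 / real (Suc n))) \<longlonglongrightarrow> 2 * m" by simp
  qed auto
  \<comment> \<open>One bound for all \<open>n\<close>, from
    \<open>1 / real (Suc n) \<le> 1\<close>: compactness asks for uniform constants, while the limit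
    uses the sharper \<open>?C n\<close>.\<close>
  define C where "C = 2 * (m + 1)"
  have CC: "?C n \<le> C" for n
  proof -
    have "1 / real (Suc n) \<le> 1" by simp
    then have "J_KE (Sig 0) (K n) (Phi n) < m + 1"
      by (intro less_le_trans[OF J add_left_mono])
    then show ?thesis unfolding C_def by simp
  qed
  have C0: "0 \<le> C" using energy_le_nonneg[OF E[of 0]] CC[of 0] by linarith
  have modulus: "c * (norm (Phi n v - Phi n u))\<^sup>2 \<le> C * (v - u)" if "0 \<le> u" "u \<le> v" "v \<le> 1" for n u v
  proof -
    have "?C n * (v - u) \<le> C * (v - u)" using CC[of n] that by (intro mult_right_mono) auto
    then show ?thesis using energy_le_modulus[OF E that, of n] by linarith
  qed
  have Phi0: "Phi n 0 = mat 1" for n using adm[of n] unfolding admissible_def by blast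
  \<comment> \<open>All curves start at the identity, so the common modulus bounds them uniformly;
    \<open>x \<le> x\<^sup>2 + 1\<close> avoids a square root.\<close>
  have bound: "norm (Phi n x) \<le> norm (mat 1 :: real^'n^'n) + (C / c + 1)" if "x \<in> {0..1}" for n x
  proof -
    have "c * (norm (Phi n x - Phi n 0))\<^sup>2 \<le> C * x" using modulus[of 0 x n] that by simp
    also have "\<dots> \<le> C" using that C0 by (simp add: mult_left_le)
    finally have "(norm (Phi n x - Phi n 0))\<^sup>2 \<le> C / c" using c_pos by (simp add: field_simps)
    moreover have "norm (Phi n x - Phi n 0) \<le> (norm (Phi n x - Phi n 0))\<^sup>2 + 1"
      using sum_power2_ge_zero[of "norm (Phi n x - Phi n 0) - 1" 0]
      by (simp add: power2_diff) (smt (verit) norm_ge_zero)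
    ultimately show ?thesis
      using norm_triangle_sub[of "Phi n x" "Phi n 0"] unfolding Phi0 by linarith
  qed
  obtain P k where P: "continuous_on {0..1} P" and k: "strict_mono (k :: nat \<Rightarrow> nat)"
    and unif: "\<And>e. 0 < e \<Longrightarrow> \<exists>N. \<forall>n x. n \<ge> N \<and> x \<in> {0..1} \<longrightarrow> norm (Phi (k n) x - P x) < e"
  proof (rule Arzela_Ascoli[of "{0..1}" Phi])
    fix x e :: real assume x: "x \<in> {0..1}" and e: "0 < e"
    obtain d where "d > 0"
      "\<And>n x y. x \<in> {0..1} \<Longrightarrow> y \<in> {0..1} \<Longrightarrow> norm (x - y) < d \<Longrightarrow> norm (Phi n x - Phi n y) < e"
      using equicontinuous_of_sqrt_modulus[OF c_pos C0 e modulus] by metis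
    then show "\<exists>d>0. \<forall>n y. y \<in> {0..1} \<and> norm (x - y) < d \<longrightarrow> norm (Phi n x - Phi n y) < e"
      using x by blast
  qed (use bound that in auto)
  have lim: "(\<lambda>n. Phi (k n) x) \<longlonglongrightarrow> P x" if "x \<in> {0..1}" for x
    using unif that unfolding LIMSEQ_iff by blast
  \<comment> \<open>Along the subsequence the bounds \<open>?C\<close> tend to \<open>2 * m\<close>,
    so the limit curve inherits exactly this bound.\<close>
  have EP: "energy_le P (2 * m)"
    by (rule energy_le_limit[OF E lim LIMSEQ_subseq_LIMSEQ[OF Clim k, unfolded comp_def]])
  have SigP: "Sig t = P t ** Sig 0 ** transpose (P t)" if t: "t \<in> {0..1}" for t
  proof (rule LIMSEQ_unique)
    show "(\<lambda>n. Phi (k n) t ** Sig 0 ** transpose (Phi (k n) t)) \<longlonglongrightarrow> P t ** Sig 0 ** transpose (P t)"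
      by (intro tendsto_matrix_matrix_mult tendsto_transpose tendsto_const lim t)
    have "Phi (k n) t ** Sig 0 ** transpose (Phi (k n) t) = Sig t" for n
      by (rule sym) (use adm[of "k n"] t in \<open>unfold admissible_def, blast\<close>)
    then show "(\<lambda>n. Phi (k n) t ** Sig 0 ** transpose (Phi (k n) t)) \<longlonglongrightarrow> Sig t" by simp
  qed
  have YP: "Y1 = P 1 ** Y0"
  proof (rule LIMSEQ_unique)
    show "(\<lambda>n. Phi (k n) 1 ** Y0) \<longlonglongrightarrow> P 1 ** Y0"
      by (intro tendsto_matrix_matrix_mult tendsto_const lim) simp
    have "Phi (k n) 1 ** Y0 = Y1" for n
      by (rule sym) (use adm[of "k n"] in \<open>unfold admissible_def, blast\<close>)
    then show "(\<lambda>n. Phi (k n) 1 ** Y0) \<longlonglongrightarrow> Y1" by simp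
  qed
  have P0: "P 0 = mat 1" using LIMSEQ_unique[OF lim[of 0]] by (simp add: Phi0)
  \<comment> \<open>Invertibility does not pass to limits by itself; it follows from
    \<open>SigP\<close>, since \<open>det (P t)\<close> is a factor of the nonzero
    \<open>det (Sig t)\<close>.\<close>
  have invP: "invertible (P t)" if t: "t \<in> {0..1}" for t
  proof -
    have "det (Sig t) \<noteq> 0" using SymPos_invertible[OF bspec[OF assms(3) t]] by (simp add: invertible_det_nz)
    then have "det (P t) \<noteq> 0" unfolding SigP[OF t] by (simp add: det_mul)
    then show ?thesis by (simp add: invertible_det_nz)
  qed
  obtain Ks where "admissible Sig Y0 Y1 Ks P" "2 * J_KE (Sig 0) Ks P \<le> 2 * m"
    using energy_le_admissible[where Sig = Sig, OF ef trS EP _ P0 _ YP] invP SigP by metis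
  then show ?thesis using mJ by force
qed

end
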